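(* A Kenmotsu pseudo-metric manifold $(M,\varphi,\xi,\eta,g)$ is $\xi$-conformally flat if and only if it is an $\eta$-Einstein manifold.
   Context: Let $M$ be a smooth manifold of dimension $2n+1$, $n\ge 1$. An almost contact pseudo-metric structure $(\varphi,\xi,\eta,g)$ on $M$ consists of a $(1,1)$-tensor field $\varphi$, a vector field $\xi$, a 1-form $\eta$ and a pseudo-Riemannian metric $g$ such that $\varphi^2=-I+\eta\otimes\xi$, $\eta(\xi)=1$, $\varphi\xi=0$, $\eta\circ\varphi=0$, and $g(\varphi X,\varphi Y)=g(X,Y)-\varepsilon\eta(X)\eta(Y)$ for all vector fields $X,Y$, where $\varepsilon=\pm1$; consequently $\eta(X)=\varepsilon g(X,\xi)$, $g(\varphi X,Y)=-g(X,\varphi Y)$ and $g(\xi,\xi)=\varepsilon$. It is a Kenmotsu pseudo-metric manifold if $(\nabla_X\varphi)Y=-\eta(Y)\varphi X-\varepsilon g(X,\varphi Y)\xi$ for all $X,Y$, where $\nabla$ is the Levi-Civita connection of $g$. Curvature: $R(X,Y)=[\nabla_X,\nabla_Y]-\nabla_{[X,Y]}$; $Ric(Y,Z)$ is the trace of $X\mapsto R(X,Y)Z$; the Ricci operator $Q$ is given by $g(QX,Y)=Ric(X,Y)$; $r$ is the scalar curvature (trace of $Q$). The conformal curvature tensor is $$C(X,Y)Z=R(X,Y)Z-\tfrac{1}{2n-1}\{Ric(Y,Z)X+g(Y,Z)QX-Ric(X,Z)Y-g(X,Z)QY\}+\tfrac{r}{2n(2n-1)}\{g(Y,Z)X-g(X,Z)Y\}.$$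 $M$ is $\xi$-conformally flat if $C(X,Y)\xi=0$ for all $X,Y$. $M$ is $\eta$-Einstein if $Ric(X,Y)=a\,g(X,Y)+b\,\eta(X)\eta(Y)$ for all $X,Y$, for some smooth functions $a,b$ on $M$. *)

theory Defs
  imports "HOL-Analysis.Analysis" "HOL-Library.Function_Algebras"
begin

section \<open>Smooth maps between Euclidean spaces\<close>

text \<open>Meaningful for open \<open>S\<close> and a finite-dimensional domain: there, existence and continuity
  of all iterated directional derivatives up to order \<open>k\<close> is \<open>C\<^sup>k\<close>-regularity.\<close>

primrec Ck_on :: "nat \<Rightarrow> 'a::euclidean_space set \<Rightarrow> ('a \<Rightarrow> 'b::real_normed_vector) \<Rightarrow> bool" where
  "Ck_on 0 S f \<longleftrightarrow> continuous_on S f"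
| "Ck_on (Suc k) S f \<longleftrightarrow> (\<forall>x\<in>S. f differentiable (at x)) \<and>
     (\<forall>v. Ck_on k S (\<lambda>x. frechet_derivative f (at x) v))"

definition smooth_on :: "'a::euclidean_space set \<Rightarrow> ('a \<Rightarrow> 'b::real_normed_vector) \<Rightarrow> bool" where
  "smooth_on S f \<longleftrightarrow> (\<forall>k. Ck_on k S f)"


section \<open>Smooth manifolds\<close>

text \<open>The underlying space of the manifold is the whole type \<open>'a\<close>. A chart is a pair \<open>(U, c)\<close>;
  the values of \<open>c\<close> outside \<open>U\<close> are irrelevant. The dimension is \<open>DIM('e)\<close>. The atlas need not be
  maximal, since an atlas and the maximal atlas it generates have the same smooth functions.\<close>

type_synonym ('a, 'e) chart = "'a set \<times> ('a \<Rightarrow> 'e)"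

definition smooth_atlas ::
    "('a::{t2_space, second_countable_topology}, 'e::euclidean_space) chart set \<Rightarrow> bool" where
  "smooth_atlas A \<longleftrightarrow>
     (\<forall>(U, c)\<in>A. open U \<and> open (c ` U) \<and> homeomorphism U (c ` U) c (inv_into U c)) \<and>
     (\<Union>(U, c)\<in>A. U) = UNIV \<and>
     (\<forall>(U, c)\<in>A. \<forall>(V, d)\<in>A. smooth_on (c ` (U \<inter> V)) (d \<circ> inv_into U c))"

definition smooth_fun ::
    "('a::{t2_space, second_countable_topology}, 'e::euclidean_space) chart set
      \<Rightarrow> ('a \<Rightarrow> real) \<Rightarrow> bool" where
  "smooth_fun A f \<longleftrightarrow> (\<forall>(U, c)\<in>A. smooth_on (c ` U) (f \<circ> inv_into U c))"


section \<open>Tangent vectors\<close>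

text \<open>Tangent vectors at \<open>p\<close> are the derivations at \<open>p\<close> of the algebra of smooth functions. They
  are total functionals in HOL, so their value on non-smooth functions is fixed to be \<open>0\<close>; otherwise
  equality of tangent vectors and the dimension of the tangent space would be wrong.\<close>

type_synonym 'a tvec = "('a \<Rightarrow> real) \<Rightarrow> real"

definition tscale :: "real \<Rightarrow> 'a tvec \<Rightarrow> 'a tvec" (infixr \<open>*\<^sub>T\<close> 75) where
  "k *\<^sub>T v = (\<lambda>f. k * v f)"

interpretation tvec: vector_space "tscale :: real \<Rightarrow> 'a tvec \<Rightarrow> 'a tvec"
  by unfold_locales (auto simp: tscale_def fun_eq_iff algebra_simps)

definition tangent_space ::
    "('a::{t2_space, second_countable_topology}, 'e::euclidean_space) chart set
      \<Rightarrow> 'a \<Rightarrow> 'a tvec set" where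
  "tangent_space A p = {v.
     (\<forall>f h. smooth_fun A f \<longrightarrow> smooth_fun A h \<longrightarrow> v (\<lambda>q. f q + h q) = v f + v h) \<and>
     (\<forall>k f. smooth_fun A f \<longrightarrow> v (\<lambda>q. k * f q) = k * v f) \<and>
     (\<forall>f h. smooth_fun A f \<longrightarrow> smooth_fun A h \<longrightarrow>
        v (\<lambda>q. f q * h q) = f p * v h + h p * v f) \<and>
     (\<forall>f. \<not> smooth_fun A f \<longrightarrow> v f = 0)}"

text \<open>The trace of an endomorphism \<open>T\<close> of the tangent space at \<open>p\<close>: the sum of the diagonal
  entries of its matrix with respect to some basis.\<close>

definition tangent_trace ::
    "('a::{t2_space, second_countable_topology}, 'e::euclidean_space) chart set
      \<Rightarrow> 'a \<Rightarrow> ('a tvec \<Rightarrow> 'a tvec) \<Rightarrow> real" where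
  "tangent_trace A p T =
     (let B = (SOME B. tvec.independent B \<and> tvec.span B = tangent_space A p)
      in \<Sum>b\<in>B. tvec.representation B (T b) b)"


section \<open>Vector fields and tensor fields\<close>

type_synonym 'a vfield = "'a \<Rightarrow> 'a tvec"

definition vector_field ::
    "('a::{t2_space, second_countable_topology}, 'e::euclidean_space) chart set
      \<Rightarrow> 'a vfield \<Rightarrow> bool" where
  "vector_field A X \<longleftrightarrow> (\<forall>p. X p \<in> tangent_space A p) \<and>
     (\<forall>f. smooth_fun A f \<longrightarrow> smooth_fun A (\<lambda>p. X p f))"

definition fmult :: "('a \<Rightarrow> real) \<Rightarrow> 'a vfield \<Rightarrow> 'a vfield" (infixr \<open>*\<^sub>F\<close> 75) where
  "f *\<^sub>F X = (\<lambda>p. f p *\<^sub>T X p)"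

definition lie_bracket :: "'a vfield \<Rightarrow> 'a vfield \<Rightarrow> 'a vfield" where
  "lie_bracket X Y = (\<lambda>p f. X p (\<lambda>q. Y q f) - Y p (\<lambda>q. X q f))"

definition one_form ::
    "('a::{t2_space, second_countable_topology}, 'e::euclidean_space) chart set
      \<Rightarrow> ('a \<Rightarrow> 'a tvec \<Rightarrow> real) \<Rightarrow> bool" where
  "one_form A \<eta> \<longleftrightarrow>
     (\<forall>p. \<forall>v\<in>tangent_space A p.
        (\<forall>w\<in>tangent_space A p. \<eta> p (v + w) = \<eta> p v + \<eta> p w) \<and>
        (\<forall>k. \<eta> p (k *\<^sub>T v) = k * \<eta> p v)) \<and>
     (\<forall>X. vector_field A X \<longrightarrow> smooth_fun A (\<lambda>p. \<eta> p (X p)))"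

definition tensor_11 ::
    "('a::{t2_space, second_countable_topology}, 'e::euclidean_space) chart set
      \<Rightarrow> ('a \<Rightarrow> 'a tvec \<Rightarrow> 'a tvec) \<Rightarrow> bool" where
  "tensor_11 A \<phi> \<longleftrightarrow>
     (\<forall>p. \<forall>v\<in>tangent_space A p.
        \<phi> p v \<in> tangent_space A p \<and>
        (\<forall>w\<in>tangent_space A p. \<phi> p (v + w) = \<phi> p v + \<phi> p w) \<and>
        (\<forall>k. \<phi> p (k *\<^sub>T v) = k *\<^sub>T \<phi> p v)) \<and>
     (\<forall>X. vector_field A X \<longrightarrow> vector_field A (\<lambda>p. \<phi> p (X p)))"

definition pseudo_riemannian_metric ::
    "('a::{t2_space, second_countable_topology}, 'e::euclidean_space) chart set
      \<Rightarrow> ('a \<Rightarrow> 'a tvec \<Rightarrow> 'a tvec \<Rightarrow> real) \<Rightarrow> bool" where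
  "pseudo_riemannian_metric A g \<longleftrightarrow>
     (\<forall>p. \<forall>u\<in>tangent_space A p. \<forall>v\<in>tangent_space A p.
        g p u v = g p v u \<and>
        (\<forall>w\<in>tangent_space A p. g p (u + v) w = g p u w + g p v w) \<and>
        (\<forall>k. g p (k *\<^sub>T u) v = k * g p u v)) \<and>
     (\<forall>p. \<forall>u\<in>tangent_space A p. (\<forall>v\<in>tangent_space A p. g p u v = 0) \<longrightarrow> u = 0) \<and>
     (\<forall>X Y. vector_field A X \<longrightarrow> vector_field A Y \<longrightarrow> smooth_fun A (\<lambda>p. g p (X p) (Y p)))"


section \<open>Levi-Civita connection and curvature\<close>

definition affine_connection ::
    "('a::{t2_space, second_countable_topology}, 'e::euclidean_space) chart set
      \<Rightarrow> ('a vfield \<Rightarrow> 'a vfield \<Rightarrow> 'a vfield) \<Rightarrow> bool" where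
  "affine_connection A nabla \<longleftrightarrow>
     (\<forall>X Y. vector_field A X \<longrightarrow> vector_field A Y \<longrightarrow>
        vector_field A (nabla X Y) \<and>
        (\<forall>Z. vector_field A Z \<longrightarrow>
           nabla (X + Y) Z = nabla X Z + nabla Y Z \<and>
           nabla Z (X + Y) = nabla Z X + nabla Z Y) \<and>
        (\<forall>f. smooth_fun A f \<longrightarrow>
           nabla (f *\<^sub>F X) Y = f *\<^sub>F nabla X Y \<and>
           nabla X (f *\<^sub>F Y) = (\<lambda>p. X p f) *\<^sub>F Y + f *\<^sub>F nabla X Y))"

definition levi_civita ::
    "('a::{t2_space, second_countable_topology}, 'e::euclidean_space) chart set
      \<Rightarrow> ('a \<Rightarrow> 'a tvec \<Rightarrow> 'a tvec \<Rightarrow> real)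
      \<Rightarrow> ('a vfield \<Rightarrow> 'a vfield \<Rightarrow> 'a vfield) \<Rightarrow> bool" where
  "levi_civita A g nabla \<longleftrightarrow> affine_connection A nabla \<and>
     (\<forall>X Y. vector_field A X \<longrightarrow> vector_field A Y \<longrightarrow>
        nabla X Y - nabla Y X = lie_bracket X Y) \<and>
     (\<forall>X Y Z. vector_field A X \<longrightarrow> vector_field A Y \<longrightarrow> vector_field A Z \<longrightarrow>
        (\<forall>p. X p (\<lambda>q. g q (Y q) (Z q)) = g p (nabla X Y p) (Z p) + g p (Y p) (nabla X Z p)))"

definition curvature ::
    "('a vfield \<Rightarrow> 'a vfield \<Rightarrow> 'a vfield) \<Rightarrow> 'a vfield \<Rightarrow> 'a vfield \<Rightarrow> 'a vfield \<Rightarrow> 'a vfield" where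
  "curvature nabla X Y Z =
     nabla X (nabla Y Z) - nabla Y (nabla X Z) - nabla (lie_bracket X Y) Z"

text \<open>Curvature acts on vector fields; to take pointwise traces, a tangent vector is extended to
  a vector field. By tensoriality the choice of the extension does not matter.\<close>

definition extend_tvec ::
    "('a::{t2_space, second_countable_topology}, 'e::euclidean_space) chart set
      \<Rightarrow> 'a \<Rightarrow> 'a tvec \<Rightarrow> 'a vfield" where
  "extend_tvec A p v = (SOME V. vector_field A V \<and> V p = v)"

definition ricci ::
    "('a::{t2_space, second_countable_topology}, 'e::euclidean_space) chart set
      \<Rightarrow> ('a vfield \<Rightarrow> 'a vfield \<Rightarrow> 'a vfield) \<Rightarrow> 'a vfield \<Rightarrow> 'a vfield \<Rightarrow> 'a \<Rightarrow> real" where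
  "ricci A nabla Y Z p =
     tangent_trace A p (\<lambda>v. curvature nabla (extend_tvec A p v) Y Z p)"

definition ricci_operator ::
    "('a::{t2_space, second_countable_topology}, 'e::euclidean_space) chart set
      \<Rightarrow> ('a \<Rightarrow> 'a tvec \<Rightarrow> 'a tvec \<Rightarrow> real)
      \<Rightarrow> ('a vfield \<Rightarrow> 'a vfield \<Rightarrow> 'a vfield) \<Rightarrow> 'a vfield \<Rightarrow> 'a vfield" where
  "ricci_operator A g nabla X p =
     (THE w. w \<in> tangent_space A p \<and>
        (\<forall>Y. vector_field A Y \<longrightarrow> g p w (Y p) = ricci A nabla X Y p))"

definition scalar_curvature ::
    "('a::{t2_space, second_countable_topology}, 'e::euclidean_space) chart set
      \<Rightarrow> ('a \<Rightarrow> 'a tvec \<Rightarrow> 'a tvec \<Rightarrow> real)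
      \<Rightarrow> ('a vfield \<Rightarrow> 'a vfield \<Rightarrow> 'a vfield) \<Rightarrow> 'a \<Rightarrow> real" where
  "scalar_curvature A g nabla p =
     tangent_trace A p (\<lambda>v. ricci_operator A g nabla (extend_tvec A p v) p)"

definition conformal_curvature ::
    "nat \<Rightarrow> ('a::{t2_space, second_countable_topology}, 'e::euclidean_space) chart set
      \<Rightarrow> ('a \<Rightarrow> 'a tvec \<Rightarrow> 'a tvec \<Rightarrow> real)
      \<Rightarrow> ('a vfield \<Rightarrow> 'a vfield \<Rightarrow> 'a vfield)
      \<Rightarrow> 'a vfield \<Rightarrow> 'a vfield \<Rightarrow> 'a vfield \<Rightarrow> 'a vfield" where
  "conformal_curvature n A g nabla X Y Z = (\<lambda>p.
     curvature nabla X Y Z p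
     - (1 / (2 * real n - 1)) *\<^sub>T
         (ricci A nabla Y Z p *\<^sub>T X p + g p (Y p) (Z p) *\<^sub>T ricci_operator A g nabla X p
          - ricci A nabla X Z p *\<^sub>T Y p - g p (X p) (Z p) *\<^sub>T ricci_operator A g nabla Y p)
     + (scalar_curvature A g nabla p / (2 * real n * (2 * real n - 1))) *\<^sub>T
         (g p (Y p) (Z p) *\<^sub>T X p - g p (X p) (Z p) *\<^sub>T Y p))"


section \<open>Kenmotsu pseudo-metric manifolds\<close>

definition almost_contact_pseudo_metric ::
    "('a::{t2_space, second_countable_topology}, 'e::euclidean_space) chart set
      \<Rightarrow> ('a \<Rightarrow> 'a tvec \<Rightarrow> 'a tvec) \<Rightarrow> 'a vfield \<Rightarrow> ('a \<Rightarrow> 'a tvec \<Rightarrow> real)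
      \<Rightarrow> ('a \<Rightarrow> 'a tvec \<Rightarrow> 'a tvec \<Rightarrow> real) \<Rightarrow> real \<Rightarrow> bool" where
  "almost_contact_pseudo_metric A \<phi> \<xi> \<eta> g \<epsilon> \<longleftrightarrow>
     tensor_11 A \<phi> \<and> vector_field A \<xi> \<and> one_form A \<eta> \<and> pseudo_riemannian_metric A g \<and>
     (\<epsilon> = 1 \<or> \<epsilon> = - 1) \<and>
     (\<forall>p. \<eta> p (\<xi> p) = 1 \<and> \<phi> p (\<xi> p) = 0 \<and>
        (\<forall>v\<in>tangent_space A p.
           \<phi> p (\<phi> p v) = - v + \<eta> p v *\<^sub>T \<xi> p \<and> \<eta> p (\<phi> p v) = 0)) \<and>
     (\<forall>X Y. vector_field A X \<longrightarrow> vector_field A Y \<longrightarrow>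
        (\<forall>p. g p (\<phi> p (X p)) (\<phi> p (Y p)) = g p (X p) (Y p) - \<epsilon> * \<eta> p (X p) * \<eta> p (Y p)))"

text \<open>The left-hand side of the last equation is \<open>(\<nabla>\<^sub>X \<phi>) Y = \<nabla>\<^sub>X (\<phi> Y) - \<phi> (\<nabla>\<^sub>X Y)\<close>.\<close>

definition kenmotsu_pseudo_metric ::
    "('a::{t2_space, second_countable_topology}, 'e::euclidean_space) chart set
      \<Rightarrow> ('a \<Rightarrow> 'a tvec \<Rightarrow> 'a tvec) \<Rightarrow> 'a vfield \<Rightarrow> ('a \<Rightarrow> 'a tvec \<Rightarrow> real)
      \<Rightarrow> ('a \<Rightarrow> 'a tvec \<Rightarrow> 'a tvec \<Rightarrow> real) \<Rightarrow> real
      \<Rightarrow> ('a vfield \<Rightarrow> 'a vfield \<Rightarrow> 'a vfield) \<Rightarrow> bool" where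
  "kenmotsu_pseudo_metric A \<phi> \<xi> \<eta> g \<epsilon> nabla \<longleftrightarrow>
     almost_contact_pseudo_metric A \<phi> \<xi> \<eta> g \<epsilon> \<and>
     (\<forall>X Y. vector_field A X \<longrightarrow> vector_field A Y \<longrightarrow>
        (\<forall>p. nabla X (\<lambda>q. \<phi> q (Y q)) p - \<phi> p (nabla X Y p) =
           - (\<eta> p (Y p) *\<^sub>T \<phi> p (X p)) - (\<epsilon> * g p (X p) (\<phi> p (Y p))) *\<^sub>T \<xi> p))"

definition xi_conformally_flat ::
    "nat \<Rightarrow> ('a::{t2_space, second_countable_topology}, 'e::euclidean_space) chart set
      \<Rightarrow> 'a vfield \<Rightarrow> ('a \<Rightarrow> 'a tvec \<Rightarrow> 'a tvec \<Rightarrow> real)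
      \<Rightarrow> ('a vfield \<Rightarrow> 'a vfield \<Rightarrow> 'a vfield) \<Rightarrow> bool" where
  "xi_conformally_flat n A \<xi> g nabla \<longleftrightarrow>
     (\<forall>X Y. vector_field A X \<longrightarrow> vector_field A Y \<longrightarrow>
        (\<forall>p. conformal_curvature n A g nabla X Y \<xi> p = 0))"

definition eta_einstein ::
    "('a::{t2_space, second_countable_topology}, 'e::euclidean_space) chart set
      \<Rightarrow> ('a \<Rightarrow> 'a tvec \<Rightarrow> real) \<Rightarrow> ('a \<Rightarrow> 'a tvec \<Rightarrow> 'a tvec \<Rightarrow> real)
      \<Rightarrow> ('a vfield \<Rightarrow> 'a vfield \<Rightarrow> 'a vfield) \<Rightarrow> bool" where
  "eta_einstein A \<eta> g nabla \<longleftrightarrow>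
     (\<exists>a b. smooth_fun A a \<and> smooth_fun A b \<and>
        (\<forall>X Y. vector_field A X \<longrightarrow> vector_field A Y \<longrightarrow>
           (\<forall>p. ricci A nabla X Y p = a p * g p (X p) (Y p) + b p * \<eta> p (X p) * \<eta> p (Y p))))"

end

theory Submission
  imports Defs
begin

text \<open>
  Two curvature identities decide everything. The Kenmotsu equation forces \<open>\<nabla>\<^sub>X \<xi> = X - \<eta>(X) \<xi>\<close>
  (lemma \<open>nabla_xi\<close>); differentiating once more, and using that \<open>\<eta>\<close> is closed, gives
  \<open>R(X, Y) \<xi> = \<eta>(X) Y - \<eta>(Y) X\<close> (lemma \<open>R_xi\<close>), and the pair symmetry of the curvature
  tensor gives \<open>R(X, \<xi>) Y = \<epsilon> g(X, Y) \<xi> - \<eta>(Y) X\<close> (lemma \<open>R_second_xi\<close>). Both are of the form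
  ``rank one plus multiple of the identity'' in the argument that the Ricci tensor contracts, so
  \<open>Ric(Y, \<xi>) = Ric(\<xi>, Y) = - 2 n \<eta>(Y)\<close> and \<open>Q \<xi> = - 2 n \<epsilon> \<xi>\<close>.

  Hence in \<open>C(X, Y) \<xi>\<close> only \<open>Q\<close> and \<open>r\<close> are unknown. If \<open>C(X, \<xi>) \<xi> = 0\<close> for all \<open>X\<close>, solving
  for \<open>Q X\<close> yields \<open>Q X = a X + \<epsilon> b \<eta>(X) \<xi>\<close> with \<open>a = \<epsilon> + r / (2 n)\<close> and \<open>b = - 2 n - \<epsilon> a\<close>, which is
  the \<open>\<eta>\<close>-Einstein condition. Conversely, the \<open>\<eta>\<close>-Einstein condition determines \<open>b\<close> through
  \<open>Ric(\<xi>, \<xi>) = - 2 n\<close> and \<open>r\<close> through the trace of \<open>Q\<close>, and substitution makes \<open>C(X, Y) \<xi>\<close> vanish.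
  The function \<open>a\<close> is smooth since locally it is the quotient of \<open>Ric(X, X)\<close> and \<open>g(X, X)\<close> for a
  horizontal field \<open>X\<close> that is not null.

  The pointwise reading of these identities rests on three facts about the tangent spaces, which
  are spaces of derivations on the algebra of global smooth functions. They have the dimension of
  the model space and global fields form local frames (lemma \<open>local_frame_exists\<close>), by Hadamard's
  lemma and bump functions; maps of vector fields that are linear over the smooth functions act
  pointwise (lemma \<open>tensorial_at_cong\<close>); and the metric represents every linear form (lemma
  \<open>riesz_exists\<close>), so that the Ricci operator exists.
\<close>

section \<open>Calculus of \<open>C\<^sup>k\<close> functions\<close>

lemma Ck_on_cong:
  assumes "open S" "\<And>x. x \<in> S \<Longrightarrow> f x = g x" "Ck_on k S f"
  shows "Ck_on k S g"
  using assms(2-)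
proof (induction k arbitrary: f g)
  case 0
  then show ?case using continuous_on_eq by auto
next
  case (Suc k)
  have d: "(g has_derivative frechet_derivative f (at x)) (at x)" if "x \<in> S" for x
  proof -
    have "(f has_derivative frechet_derivative f (at x)) (at x)"
      using Suc.prems(2) that frechet_derivative_works by auto
    then show ?thesis
      by (rule has_derivative_transform_within_open[OF _ \<open>open S\<close> that]) (use Suc.prems(1) in auto)
  qed
  have "frechet_derivative f (at x) = frechet_derivative g (at x)" if "x \<in> S" for x
    using frechet_derivative_at[OF d[OF that]] .
  then have "Ck_on k S (\<lambda>x. frechet_derivative g (at x) v)" for v
    using Suc.IH[of "\<lambda>x. frechet_derivative f (at x) v"] Suc.prems(2) by simp
  with d show ?case by (auto simp: differentiable_def)
qed

text \<open>The way every closure property of \<open>C\<^sup>k\<close> below is proved: exhibit a derivative, check that its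
  components are one order less smooth, and let the induction on the order do the rest.\<close>

lemma Ck_on_has_derivativeI:
  assumes "open S" "\<And>x. x \<in> S \<Longrightarrow> (f has_derivative D x) (at x)"
    and "\<And>v. Ck_on k S (\<lambda>x. D x v)"
  shows "Ck_on (Suc k) S f"
proof -
  have "D x = frechet_derivative f (at x)" if "x \<in> S" for x
    using frechet_derivative_at[OF assms(2)[OF that]] .
  then have "Ck_on k S (\<lambda>x. frechet_derivative f (at x) v)" for v
    by (intro Ck_on_cong[OF assms(1) _ assms(3)[of v]]) simp
  with assms(2) show ?thesis by (auto simp: differentiable_def)
qed

lemma Ck_on_subset: "Ck_on k S f \<Longrightarrow> T \<subseteq> S \<Longrightarrow> Ck_on k T f"
  by (induction k arbitrary: f) (auto intro: continuous_on_subset)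

lemma Ck_on_SucD: "Ck_on (Suc k) S f \<Longrightarrow> Ck_on k S f"
proof (induction k arbitrary: f)
  case 0
  then show ?case
    by (auto intro!: differentiable_imp_continuous_on differentiable_at_imp_differentiable_on)
qed auto

lemma Ck_on_imp_continuous_on: "Ck_on k S f \<Longrightarrow> continuous_on S f"
  by (induction k) (auto dest: Ck_on_SucD simp del: Ck_on.simps(2))

lemma Ck_on_Suc_has_derivative:
  "Ck_on (Suc k) S f \<Longrightarrow> x \<in> S \<Longrightarrow> (f has_derivative frechet_derivative f (at x)) (at x)"
  using frechet_derivative_works by auto

lemma Ck_on_locally:
  assumes "\<And>x. x \<in> S \<Longrightarrow> \<exists>T. open T \<and> x \<in> T \<and> Ck_on k T f"
  shows "Ck_on k S f"
  using assms
proof (induction k arbitrary: f)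
  case 0
  have "isCont f x" if "x \<in> S" for x
    using 0[OF that] by (auto simp: continuous_on_eq_continuous_at)
  then show ?case by (simp add: continuous_at_imp_continuous_on)
next
  case (Suc k)
  have "Ck_on k S (\<lambda>x. frechet_derivative f (at x) v)" for v
    by (rule Suc.IH) (use Suc.prems in force)
  moreover have "\<forall>x\<in>S. f differentiable at x"
    using Suc.prems by force
  ultimately show ?case by auto
qed

lemma Ck_on_const: "open S \<Longrightarrow> Ck_on k S (\<lambda>x. c)"
proof (induction k arbitrary: c)
  case (Suc k)
  show ?case by (rule Ck_on_has_derivativeI[where D = "\<lambda>_ _. 0"]) (use Suc in auto)
qed auto

lemma Ck_on_bounded_linear_comp:
  assumes "open S" "bounded_linear L" "Ck_on k S f"
  shows "Ck_on k S (\<lambda>x. L (f x))"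
  using assms(3)
proof (induction k arbitrary: f)
  case 0
  then show ?case using bounded_linear.continuous_on[OF assms(2)] by auto
next
  case (Suc k)
  show ?case
    by (rule Ck_on_has_derivativeI[OF \<open>open S\<close>
          bounded_linear.has_derivative[OF assms(2) Ck_on_Suc_has_derivative[OF Suc.prems]]])
       (use Suc in auto)
qed

lemma Ck_on_bounded_linear:
  assumes "open S" "bounded_linear L" shows "Ck_on k S L"
proof (cases k)
  case 0
  then show ?thesis using linear_continuous_on[OF assms(2)] by auto
next
  case (Suc m)
  have "Ck_on (Suc m) S L"
    by (rule Ck_on_has_derivativeI[where D="\<lambda>_. L"])
       (use assms in \<open>auto intro: bounded_linear.has_derivative Ck_on_const bounded_linear_imp_has_derivative\<close>)
  with Suc show ?thesis by simp
qed

lemma Ck_on_add: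
  assumes "open S" "Ck_on k S f" "Ck_on k S g"
  shows "Ck_on k S (\<lambda>x. f x + g x)"
  using assms(2-)
proof (induction k arbitrary: f g)
  case 0
  then show ?case by (simp add: continuous_on_add continuous_on_mult)
next
  case (Suc k)
  show ?case
    by (rule Ck_on_has_derivativeI[OF \<open>open S\<close> has_derivative_add[OF
          Ck_on_Suc_has_derivative[OF Suc.prems(1)] Ck_on_Suc_has_derivative[OF Suc.prems(2)]]])
       (use Suc in auto)
qed

lemma Ck_on_sum:
  assumes "open S" "\<And>i. i \<in> I \<Longrightarrow> Ck_on k S (f i)"
  shows "Ck_on k S (\<lambda>x. \<Sum>i\<in>I. f i x)"
  using assms(2)
  by (induction I rule: infinite_finite_induct) (auto intro: Ck_on_add Ck_on_const assms(1))

lemma Ck_on_mult: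
  fixes f g :: "'a::euclidean_space \<Rightarrow> real"
  assumes "open S" "Ck_on k S f" "Ck_on k S g"
  shows "Ck_on k S (\<lambda>x. f x * g x)"
  using assms(2-)
proof (induction k arbitrary: f g)
  case 0
  then show ?case by (simp add: continuous_on_add continuous_on_mult)
next
  case (Suc k)
  show ?case
    by (rule Ck_on_has_derivativeI[OF \<open>open S\<close> has_derivative_mult[OF
          Ck_on_Suc_has_derivative[OF Suc.prems(1)] Ck_on_Suc_has_derivative[OF Suc.prems(2)]]])
       (use Suc Ck_on_SucD[OF Suc.prems(1)] Ck_on_SucD[OF Suc.prems(2)] in
         \<open>auto intro!: Ck_on_add[OF \<open>open S\<close>]\<close>)
qed

lemma Ck_on_compose:
  fixes h :: "'b::euclidean_space \<Rightarrow> real" and G :: "'a::euclidean_space \<Rightarrow> 'b"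
  assumes "open S" "open T" "G ` S \<subseteq> T" "Ck_on k T h" "Ck_on k S G"
  shows "Ck_on k S (\<lambda>x. h (G x))"
  using assms(4-)
proof (induction k arbitrary: h)
  case 0
  then show ?case using assms(3) by (auto intro: continuous_on_compose2)
next
  case (Suc k)
  let ?D = "\<lambda>x. frechet_derivative G (at x)"
  let ?H = "\<lambda>x. frechet_derivative h (at (G x))"
  have d: "((\<lambda>x. h (G x)) has_derivative (\<lambda>v. \<Sum>i\<in>Basis. (?D x v \<bullet> i) * ?H x i)) (at x)"
    if "x \<in> S" for x
  proof -
    have dG: "(G has_derivative ?D x) (at x)"
      by (rule Ck_on_Suc_has_derivative[OF Suc.prems(2) that])
    have dh: "(h has_derivative ?H x) (at (G x))"
      by (rule Ck_on_Suc_has_derivative[OF Suc.prems(1)]) (use that assms(3) in auto)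
    have lin: "linear (?H x)"
      using dh has_derivative_linear by blast
    have eq: "?H x w = (\<Sum>i\<in>Basis. (w \<bullet> i) * ?H x i)" for w
      using linear_sum[OF lin, of "\<lambda>i. (w \<bullet> i) *\<^sub>R i" Basis]
      by (simp add: euclidean_representation linear_scale[OF lin])
    have "((\<lambda>x. h (G x)) has_derivative (\<lambda>v. ?H x (?D x v))) (at x)"
      using has_derivative_compose[OF dG dh] .
    then show ?thesis by (subst (asm) eq)
  qed
  have G: "Ck_on k S G" by (rule Ck_on_SucD[OF Suc.prems(2)])
  have 1: "Ck_on k S (\<lambda>x. ?D x v \<bullet> i)" for v i
    by (rule Ck_on_bounded_linear_comp[OF \<open>open S\<close> bounded_linear_inner_left])
       (use Suc.prems in auto)
  have 2: "Ck_on k S (\<lambda>x. ?H x i)" for i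
    by (rule Suc.IH[OF _ G]) (use Suc.prems in auto)
  show ?case
    by (rule Ck_on_has_derivativeI[OF \<open>open S\<close> d])
       (auto intro!: Ck_on_sum Ck_on_mult 1 2 \<open>open S\<close>)
qed

lemma Ck_on_inverse:
  fixes f :: "'a::euclidean_space \<Rightarrow> real"
  assumes "open S" "Ck_on k S f" "\<And>x. x \<in> S \<Longrightarrow> f x \<noteq> 0"
  shows "Ck_on k S (\<lambda>x. inverse (f x))"
  using assms(2)
proof (induction k)
  case 0
  then show ?case using assms(3) by (simp add: continuous_on_inverse)
next
  case (Suc k)
  note i = Suc.IH[OF Ck_on_SucD[OF Suc.prems]]
  have "Ck_on k S (\<lambda>x. (-1) * (inverse (f x) * frechet_derivative f (at x) v * inverse (f x)))" for v
    by (intro Ck_on_mult i Ck_on_const \<open>open S\<close>) (use Suc.prems in auto)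
  then show ?case
    by (intro Ck_on_has_derivativeI[OF \<open>open S\<close> Deriv.has_derivative_inverse[OF assms(3) Ck_on_Suc_has_derivative[OF Suc.prems]]]) auto
qed

lemma Ck_on_inner_self: "open S \<Longrightarrow> Ck_on k S (\<lambda>x. (x - a) \<bullet> (x - a))"
proof -
  assume S: "open S"
  have "Ck_on k S (\<lambda>x. \<Sum>i\<in>Basis. (x \<bullet> i + - (a \<bullet> i)) * (x \<bullet> i + - (a \<bullet> i)))"
    by (intro Ck_on_sum Ck_on_mult Ck_on_add Ck_on_const S Ck_on_bounded_linear bounded_linear_inner_left)
  then show ?thesis by (subst euclidean_inner) (simp add: inner_diff_left)
qed

section \<open>Bump functions and Hadamard's lemma\<close>

text \<open>For \<open>P = 1\<close> this is the classical flat function \<open>exp (- 1 / t)\<close>. The polynomial factor is there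
  because the family is then closed under differentiation, so that a single induction gives
  smoothness of all its members, also at \<open>0\<close>.\<close>

definition exp_tail :: "real poly \<Rightarrow> real \<Rightarrow> real" where
  "exp_tail P t = (if t \<le> 0 then 0 else poly P (1/t) * exp (- (1/t)))"

lemma poly_times_exp_minus_tendsto_0: "((\<lambda>x::real. poly P x * exp (- x)) \<longlongrightarrow> 0) at_top"
proof -
  have "((\<lambda>x. \<Sum>i\<le>degree P. coeff P i * (x ^ i / exp x)) \<longlongrightarrow> (\<Sum>i\<le>degree P. coeff P i * 0)) at_top"
    by (intro tendsto_sum tendsto_mult tendsto_const tendsto_power_div_exp_0)
  then show ?thesis
    by (simp add: poly_altdef exp_minus sum_distrib_right divide_inverse mult.assoc)
qed

lemma exp_tail_has_derivative:
  "(exp_tail P has_field_derivative exp_tail (monom 1 2 * (P - pderiv P)) t) (at t)"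
proof (cases t "0::real" rule: linorder_cases)
  case less
  show ?thesis
    by (rule has_field_derivative_transform_within_open[where f="\<lambda>_. 0" and S="{..<0}"])
       (use less in \<open>auto simp: exp_tail_def\<close>)
next
  case greater
  have "((\<lambda>t. poly P (1/t) * exp (- (1/t))) has_field_derivative
      exp_tail (monom 1 2 * (P - pderiv P)) t) (at t)"
    using greater
    by (auto intro!: derivative_eq_intros DERIV_chain2[OF poly_DERIV]
        simp: exp_tail_def poly_monom field_simps power2_eq_square)
  then show ?thesis
    by (rule has_field_derivative_transform_within_open[where S="{0<..}"])
       (use greater in \<open>auto simp: exp_tail_def\<close>)
next
  case equal
  have r: "((\<lambda>y. exp_tail P y / y) \<longlongrightarrow> 0) (at_right 0)"
    unfolding filterlim_at_right_to_top
  proof (rule Lim_transform_eventually[OF poly_times_exp_minus_tendsto_0[of "pCons 0 P"]])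
    show "\<forall>\<^sub>F x in at_top. poly (pCons 0 P) x * exp (- x) = exp_tail P (inverse x) / inverse x"
      using eventually_gt_at_top[of "0::real"]
      by eventually_elim (auto simp: exp_tail_def field_simps)
  qed
  have l: "((\<lambda>y. exp_tail P y / y) \<longlongrightarrow> 0) (at_left 0)"
    by (rule Lim_transform_eventually[OF tendsto_const])
       (auto simp: exp_tail_def eventually_at_filter)
  show ?thesis
    using filterlim_split_at[OF l r] equal by (simp add: has_field_derivative_iff exp_tail_def)
qed

lemma Ck_on_exp_tail: "Ck_on k UNIV (exp_tail P)"
proof (induction k arbitrary: P)
  case 0
  show ?case
    using DERIV_isCont[OF exp_tail_has_derivative] by (simp add: continuous_at_imp_continuous_on)
next
  case (Suc k)
  show ?case
    by (rule Ck_on_has_derivativeI[OF _ exp_tail_has_derivative[unfolded has_field_derivative_def]])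
       (auto intro!: Ck_on_mult Ck_on_const Suc)
qed

lemma exp_tail_1_mono: "s \<le> t \<Longrightarrow> exp_tail 1 s \<le> exp_tail 1 t"
  by (auto simp: exp_tail_def intro: divide_left_mono frac_le)

lemma smooth_bump_exists:
  fixes a :: "'e::euclidean_space"
  assumes "r > 0"
  obtains \<beta> :: "'e \<Rightarrow> real" where "smooth_on UNIV \<beta>"
    "\<And>y. y \<in> cball a r \<Longrightarrow> \<beta> y = 1" "\<And>y. y \<notin> ball a (2*r) \<Longrightarrow> \<beta> y = 0"
proof
  let ?h = "exp_tail 1"
  let ?m = "?h (3 * r\<^sup>2)"
  \<comment> \<open>Applying the flat function twice gives a plateau: the inner value vanishes near
    \<open>a\<close> and is at least \<open>?m\<close> far away.\<close>
  let ?\<beta> = "\<lambda>y::'e. ?h (?m + (-1) * ?h ((y - a) \<bullet> (y - a) + - r\<^sup>2)) * (1 / ?h ?m)"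
  have pos: "?h t > 0" if "t > 0" for t using that by (simp add: exp_tail_def)
  have m: "?m > 0" using pos assms by simp
  have sq: "(y - a) \<bullet> (y - a) = (dist a y)\<^sup>2" for y
    by (subst dist_commute) (simp add: dist_norm power2_norm_eq_inner)
  show "smooth_on UNIV ?\<beta>"
    unfolding smooth_on_def
    by (intro allI Ck_on_mult Ck_on_const open_UNIV
        Ck_on_compose[OF _ open_UNIV _ Ck_on_exp_tail] Ck_on_add Ck_on_inner_self) auto
  show "?\<beta> y = 1" if "y \<in> cball a r" for y
  proof -
    have "(dist a y)\<^sup>2 \<le> r\<^sup>2" using that by (auto intro!: power_mono)
    then have "?h ((y - a) \<bullet> (y - a) + - r\<^sup>2) = 0" unfolding sq by (simp add: exp_tail_def)
    then show ?thesis using pos[OF m] by simp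
  qed
  show "?\<beta> y = 0" if "y \<notin> ball a (2*r)" for y
  proof -
    have "(2*r)\<^sup>2 \<le> (dist a y)\<^sup>2" using that assms by (intro power_mono) auto
    then have "?m \<le> ?h ((y - a) \<bullet> (y - a) + - r\<^sup>2)"
      unfolding sq by (intro exp_tail_1_mono) (simp add: power2_eq_square)
    then have "?h (?m + (-1) * ?h ((y - a) \<bullet> (y - a) + - r\<^sup>2)) = 0"
      by (subst exp_tail_def) simp
    then show ?thesis by simp
  qed
qed

lemma segment_in_ball:
  fixes a :: "'e::euclidean_space"
  assumes "y \<in> ball a \<rho>" "t \<in> {0..1}"
  shows "a + t *\<^sub>R (y - a) \<in> ball a \<rho>"
proof -
  have "t * norm (y - a) \<le> norm (y - a)"
    using assms(2) by (intro mult_left_le_one_le) auto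
  then show ?thesis
    using assms by (auto simp: dist_norm norm_minus_commute)
qed

lemma continuous_on_segment_comp:
  fixes a :: "'e::euclidean_space" and F :: "'e \<Rightarrow> real"
  assumes "continuous_on (ball a \<rho>) F"
  shows "continuous_on (ball a \<rho> \<times> {0..1}) (\<lambda>(y, t). t ^ m * F (a + t *\<^sub>R (y - a)))"
  unfolding split_beta
  by (intro continuous_intros continuous_on_compose2[OF assms])
     (use segment_in_ball in force)

text \<open>Differentiation under the integral sign turns the weight \<open>t ^ m\<close> into \<open>t ^ Suc m\<close>, by the inner
  derivative of \<open>a + t *\<^sub>R (y - a)\<close>; the weight is therefore a parameter of the induction.\<close>

lemma Ck_on_segment_integral:
  fixes a :: "'e::euclidean_space" and F :: "'e \<Rightarrow> real"
  assumes "Ck_on k (ball a \<rho>) F"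
  shows "Ck_on k (ball a \<rho>) (\<lambda>y. integral {0..1} (\<lambda>t. t ^ m * F (a + t *\<^sub>R (y - a))))"
  using assms
proof (induction k arbitrary: F m)
  case 0
  have "continuous_on (ball a \<rho>) (\<lambda>y. integral (cbox 0 1) (\<lambda>t. t ^ m * F (a + t *\<^sub>R (y - a))))"
    by (rule integral_continuous_on_param) (use continuous_on_segment_comp 0 in simp)
  then show ?case by simp
next
  case (Suc k)
  let ?B = "ball a \<rho>"
  let ?D = "\<lambda>y. frechet_derivative F (at y)"
  define \<Phi> where "\<Phi> = (\<lambda>y t. (t ^ Suc m) *\<^sub>R Blinfun (?D (a + t *\<^sub>R (y - a))))"
  have dF: "(F has_derivative ?D y) (at y)" if "y \<in> ?B" for y
    by (rule Ck_on_Suc_has_derivative[OF Suc.prems that])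
  have \<Phi>: "\<Phi> y t v = t ^ Suc m * ?D (a + t *\<^sub>R (y - a)) v" if "y \<in> ?B" "t \<in> {0..1}" for y t v
    using has_derivative_bounded_linear[OF dF[OF segment_in_ball[OF that]]]
    by (simp add: \<Phi>_def bounded_linear_Blinfun_apply scaleR_blinfun.rep_eq)
  have contD: "continuous_on ?B (\<lambda>y. ?D y v)" for v
    by (rule Ck_on_imp_continuous_on[of k]) (use Suc.prems in auto)
  have der: "((\<lambda>y. t ^ m * F (a + t *\<^sub>R (y - a))) has_derivative \<Phi> y t) (at y within ?B)"
    if yt: "y \<in> ?B" "t \<in> cbox 0 1" for y t
  proof -
    have lin: "linear (?D (a + t *\<^sub>R (y - a)))"
      using dF[OF segment_in_ball] yt has_derivative_linear by fastforce
    have g: "((\<lambda>y. a + t *\<^sub>R (y - a)) has_derivative (\<lambda>v. t *\<^sub>R v)) (at y within ?B)"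
      by (auto intro!: derivative_eq_intros)
    have "((\<lambda>y. F (a + t *\<^sub>R (y - a))) has_derivative (\<lambda>v. ?D (a + t *\<^sub>R (y - a)) (t *\<^sub>R v))) (at y within ?B)"
      by (rule has_derivative_compose[OF g dF[OF segment_in_ball]]) (use yt in auto)
    then have "((\<lambda>y. t ^ m * F (a + t *\<^sub>R (y - a))) has_derivative
        (\<lambda>v. t ^ m * ?D (a + t *\<^sub>R (y - a)) (t *\<^sub>R v))) (at y within ?B)"
      by (rule has_derivative_mult_right)
    also have "(\<lambda>v. t ^ m * ?D (a + t *\<^sub>R (y - a)) (t *\<^sub>R v)) = \<Phi> y t"
      using yt by (auto simp: fun_eq_iff \<Phi> linear_scale[OF lin])
    finally show ?thesis .
  qed
  have cont: "continuous_on (?B \<times> cbox 0 1) (\<lambda>(y, t). \<Phi> y t)"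
  proof (rule continuous_on_blinfun_componentwise)
    fix i :: 'e
    have "continuous_on (?B \<times> cbox 0 1) (\<lambda>(y, t). t ^ Suc m * ?D (a + t *\<^sub>R (y - a)) i)"
      using continuous_on_segment_comp[OF contD] by (simp only: box_real)
    then show "continuous_on (?B \<times> cbox 0 1) (\<lambda>x. (case x of (y, t) \<Rightarrow> \<Phi> y t) i)"
      by (rule continuous_on_eq) (auto simp: \<Phi> simp del: power_Suc)
  qed
  have int: "(\<lambda>t. t ^ m * F (a + t *\<^sub>R (y - a))) integrable_on cbox 0 1" if "y \<in> ?B" for y
  proof -
    have "continuous_on {0..1} (\<lambda>t. t ^ m * F (a + t *\<^sub>R (y - a)))"
      by (intro continuous_intros continuous_on_compose2[OF Ck_on_imp_continuous_on[OF Suc.prems]])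
         (use segment_in_ball[OF that] in auto)
    then show ?thesis by (metis box_real(2) integrable_continuous_real)
  qed
  have d: "((\<lambda>y. integral {0..1} (\<lambda>t. t ^ m * F (a + t *\<^sub>R (y - a)))) has_derivative
      (\<lambda>v. integral {0..1} (\<lambda>t. t ^ Suc m * ?D (a + t *\<^sub>R (y - a)) v))) (at y)" if y: "y \<in> ?B" for y
  proof -
    have "((\<lambda>y. integral (cbox 0 1) (\<lambda>t. t ^ m * F (a + t *\<^sub>R (y - a)))) has_derivative
       integral (cbox 0 1) (\<Phi> y)) (at y within ?B)"
      by (rule leibniz_rule[OF der int cont y]) auto
    moreover have "\<Phi> y integrable_on cbox 0 1"
    proof (rule integrable_continuous)
      have p: "continuous_on (cbox 0 1) (Pair y)" by (intro continuous_intros)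
      have "continuous_on (cbox 0 1) (\<lambda>t. case (y, t) of (y, t) \<Rightarrow> \<Phi> y t)"
        by (rule continuous_on_compose2[OF cont p]) (use y in auto)
      then show "continuous_on (cbox 0 1) (\<Phi> y)" by simp
    qed
    then have "blinfun_apply (integral (cbox 0 1) (\<Phi> y)) = (\<lambda>v. integral {0..1} (\<lambda>t. t ^ Suc m * ?D (a + t *\<^sub>R (y - a)) v))"
      by (auto simp: fun_eq_iff blinfun_apply_integral \<Phi>[OF y] intro!: integral_cong)
    ultimately show ?thesis
      using at_within_open[OF y open_ball] by simp
  qed
  show ?case
    by (rule Ck_on_has_derivativeI[OF open_ball d]) (use Suc in \<open>auto simp del: power_Suc\<close>)
qed

text \<open>The coefficient \<open>h i y\<close> is the mean of the \<open>i\<close>-th partial derivative over the segment from \<open>a\<close> to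
  \<open>y\<close>, and the expansion is the fundamental theorem of calculus along that segment.\<close>

lemma hadamard:
  fixes a :: "'e::euclidean_space" and f :: "'e \<Rightarrow> real"
  assumes "smooth_on (ball a \<rho>) f" "\<rho> > 0"
  shows "\<exists>h. (\<forall>i. smooth_on (ball a \<rho>) (h i)) \<and> (\<forall>i. h i a = frechet_derivative f (at a) i) \<and>
     (\<forall>y\<in>ball a \<rho>. f y = f a + (\<Sum>i\<in>Basis. ((y - a) \<bullet> i) * h i y))"
proof (intro exI conjI allI ballI)
  let ?D = "\<lambda>y. frechet_derivative f (at y)"
  let ?B = "ball a \<rho>"
  let ?h = "\<lambda>i y. integral {0..1} (\<lambda>t. t ^ 0 * ?D (a + t *\<^sub>R (y - a)) i)"
  have Ck: "Ck_on k ?B (\<lambda>y. ?D y i)" for k i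
    using assms(1) unfolding smooth_on_def using Ck_on.simps(2) by blast
  show "smooth_on ?B (?h i)" for i
    unfolding smooth_on_def by (intro allI Ck_on_segment_integral Ck)
  show "?h i a = ?D a i" for i by simp
  fix y assume y: "y \<in> ?B"
  have df: "(f has_derivative ?D z) (at z)" if "z \<in> ?B" for z
    using Ck_on_Suc_has_derivative[of 0] assms(1) that unfolding smooth_on_def by blast
  have int: "(\<lambda>t. ?D (a + t *\<^sub>R (y - a)) i) integrable_on {0..1}" for i
    by (intro integrable_continuous_real continuous_on_compose2[OF Ck_on_imp_continuous_on[OF Ck[of 0]]] continuous_intros)
       (use segment_in_ball[OF y] in auto)
  have "((\<lambda>t. f (a + t *\<^sub>R (y - a))) has_vector_derivative ?D (a + t *\<^sub>R (y - a)) (y - a)) (at t within {0..1})"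
    if "t \<in> {0..1}" for t
  proof -
    note dt = df[OF segment_in_ball[OF y that]]
    have g: "((\<lambda>t. a + t *\<^sub>R (y - a)) has_derivative (\<lambda>s. s *\<^sub>R (y - a))) (at t within {0..1})"
      by (auto intro!: derivative_eq_intros)
    show ?thesis
      using has_derivative_compose[OF g dt] linear_scale[OF has_derivative_linear[OF dt]]
      by (simp add: has_vector_derivative_def)
  qed
  from fundamental_theorem_of_calculus[OF _ this]
  have "integral {0..1} (\<lambda>t. ?D (a + t *\<^sub>R (y - a)) (y - a)) = f y - f a"
    by (intro integral_unique) auto
  moreover have "integral {0..1} (\<lambda>t. ?D (a + t *\<^sub>R (y - a)) (y - a))
      = integral {0..1} (\<lambda>t. \<Sum>i\<in>Basis. ((y - a) \<bullet> i) * ?D (a + t *\<^sub>R (y - a)) i)"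
  proof (rule integral_cong)
    fix t :: real assume "t \<in> {0..1}"
    note lin = has_derivative_linear[OF df[OF segment_in_ball[OF y this]]]
    show "?D (a + t *\<^sub>R (y - a)) (y - a) = (\<Sum>i\<in>Basis. ((y - a) \<bullet> i) * ?D (a + t *\<^sub>R (y - a)) i)"
      using linear_sum[OF lin, of "\<lambda>i. ((y - a) \<bullet> i) *\<^sub>R i" Basis]
      by (simp only: euclidean_representation linear_scale[OF lin] real_scaleR_def)
  qed
  moreover have "\<dots> = (\<Sum>i\<in>Basis. ((y - a) \<bullet> i) * ?h i y)"
    by (subst integral_sum) (use integrable_on_cmult_left[OF int] in auto)
  ultimately show "f y = f a + (\<Sum>i\<in>Basis. ((y - a) \<bullet> i) * ?h i y)" by simp
qed

section \<open>Smooth functions, derivations and local frames\<close>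

lemma sum_fun_apply: "(\<Sum>i\<in>I. F i) x = (\<Sum>i\<in>I. F i x)"
  by (induction I rule: infinite_finite_induct) auto

locale smooth_manifold =
  fixes A :: "('a::{t2_space, second_countable_topology}, 'e::euclidean_space) chart set"
  assumes atlas: "smooth_atlas A"
begin

abbreviation "smooth \<equiv> smooth_fun A"
abbreviation "T \<equiv> tangent_space A"
abbreviation "VF \<equiv> vector_field A"

lemma chart_homeo:
  assumes "(U, c) \<in> A"
  shows "open U" "open (c ` U)" "homeomorphism U (c ` U) c (inv_into U c)"
  using atlas assms unfolding smooth_atlas_def by blast+

lemma chart_inv: "(U, c) \<in> A \<Longrightarrow> x \<in> U \<Longrightarrow> inv_into U c (c x) = x"
  using chart_homeo(3) homeomorphism_apply1 by blast

lemma chart_at: obtains U c where "(U, c) \<in> A" "p \<in> U"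
  using atlas unfolding smooth_atlas_def by blast

lemma chart_open_image:
  assumes "(U, c) \<in> A" "open W" shows "open (c ` (U \<inter> W))"
proof -
  note h = chart_homeo[OF assms(1)]
  have "openin (top_of_set U) (U \<inter> W)" by (rule openin_open_Int[OF assms(2)])
  from homeomorphism_imp_open_map[OF h(3) this] show ?thesis
    using h(2) by (rule openin_open_trans)
qed

lemma chart_open_preimage:
  assumes "(U, c) \<in> A" "open S" shows "open (U \<inter> c -` S)"
  using continuous_open_preimage[OF homeomorphism_cont1 _ assms(2)] chart_homeo[OF assms(1)] by blast

lemma smooth_Ck:
  "smooth f \<Longrightarrow> (U, c) \<in> A \<Longrightarrow> Ck_on k (c ` U) (f \<circ> inv_into U c)"
  unfolding smooth_fun_def smooth_on_def by blast

lemma smoothI: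
  "(\<And>U c k. (U, c) \<in> A \<Longrightarrow> Ck_on k (c ` U) (f \<circ> inv_into U c)) \<Longrightarrow> smooth f"
  unfolding smooth_fun_def smooth_on_def by auto

lemma smooth_const [simp]: "smooth (\<lambda>_. k)"
  by (rule smoothI) (auto simp: comp_def intro: Ck_on_const chart_homeo)

lemma smooth_add: "smooth f \<Longrightarrow> smooth h \<Longrightarrow> smooth (\<lambda>q. f q + h q)"
  unfolding smooth_fun_def smooth_on_def
  using Ck_on_add[OF chart_homeo(2)] by (fastforce simp: comp_def)

lemma smooth_mult: "smooth f \<Longrightarrow> smooth h \<Longrightarrow> smooth (\<lambda>q. f q * h q)"
  unfolding smooth_fun_def smooth_on_def
  using Ck_on_mult[OF chart_homeo(2)] by (fastforce simp: comp_def)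

lemma smooth_sum: "(\<And>i. i \<in> I \<Longrightarrow> smooth (f i)) \<Longrightarrow> smooth (\<lambda>q. \<Sum>i\<in>I. f i q)"
  by (induction I rule: infinite_finite_induct) (auto intro: smooth_add)

lemma smooth_minus: "smooth f \<Longrightarrow> smooth (\<lambda>q. - f q)"
  using smooth_mult[of "\<lambda>_. -1" f] by simp

lemma smooth_diff: "smooth f \<Longrightarrow> smooth h \<Longrightarrow> smooth (\<lambda>q. f q - h q)"
  using smooth_add[OF _ smooth_minus, of f h] by simp

text \<open>Smoothness is local, and a quotient of smooth functions is smooth where the denominator does not
  vanish. The quotient form recovers a coefficient of a smooth tensor equation locally.\<close>

lemma smooth_locally_quotient:
  assumes "\<And>p. \<exists>W u w. open W \<and> p \<in> W \<and> smooth u \<and> smooth w \<and> (\<forall>q\<in>W. w q \<noteq> 0 \<and> f q = u q / w q)"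
  shows "smooth f"
proof (rule smoothI, rule Ck_on_locally)
  fix U c k x assume c: "(U, c) \<in> A" and x: "x \<in> c ` U"
  let ?i = "inv_into U c"
  obtain p where p: "p \<in> U" "x = c p" using x by blast
  obtain W u w where W: "open W" "p \<in> W" "smooth u" "smooth w"
    "\<And>q. q \<in> W \<Longrightarrow> w q \<noteq> 0" "\<And>q. q \<in> W \<Longrightarrow> f q = u q / w q"
    using assms[of p] by blast
  let ?T = "c ` (U \<inter> W)"
  have T: "open ?T" by (rule chart_open_image[OF c W(1)])
  have iT: "?i y \<in> W" if "y \<in> ?T" for y using that chart_inv[OF c] by auto
  have Ck: "Ck_on k ?T (f \<circ> ?i)" if "smooth f" for f
    by (rule Ck_on_subset[OF smooth_Ck[OF that c]]) auto
  have "Ck_on k ?T (\<lambda>y. (u \<circ> ?i) y * inverse ((w \<circ> ?i) y))"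
    by (intro Ck_on_mult Ck_on_inverse T Ck W) (auto simp: iT W)
  then have "Ck_on k ?T (f \<circ> ?i)"
    by (rule Ck_on_cong[OF T, rotated]) (use iT in \<open>auto simp: W divide_inverse\<close>)
  then show "\<exists>T. open T \<and> x \<in> T \<and> Ck_on k T (f \<circ> ?i)" using T p W(2) by blast
qed

lemma smooth_locally:
  assumes "\<And>p. \<exists>W u. open W \<and> p \<in> W \<and> smooth u \<and> (\<forall>q\<in>W. f q = u q)"
  shows "smooth f"
proof (rule smooth_locally_quotient)
  fix p
  obtain W u where "open W" "p \<in> W" "smooth u" "\<forall>q\<in>W. f q = u q" using assms by blast
  then show "\<exists>W u w. open W \<and> p \<in> W \<and> smooth u \<and> smooth w \<and> (\<forall>q\<in>W. w q \<noteq> 0 \<and> f q = u q / w q)"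
    by (intro exI[of _ W] exI[of _ u] exI[of _ "\<lambda>_. 1"]) auto
qed

text \<open>The source of all global smooth functions and fields used below: local data in a chart, cut off to
  compact support.\<close>

lemma smooth_nonzero_open:
  assumes "smooth f" "f p \<noteq> 0"
  shows "\<exists>W. open W \<and> p \<in> W \<and> (\<forall>q\<in>W. f q \<noteq> 0)"
proof -
  obtain U c where c: "(U, c) \<in> A" "p \<in> U" using chart_at by blast
  let ?i = "inv_into U c"
  let ?S = "c ` U \<inter> (f \<circ> ?i) -` (- {0})"
  have "continuous_on (c ` U) (f \<circ> ?i)"
    by (rule Ck_on_imp_continuous_on[OF smooth_Ck[OF assms(1) c(1), of 0]])
  then have "open ?S"
    by (rule continuous_open_preimage) (use chart_homeo(2)[OF c(1)] in auto)
  then have "open (U \<inter> c -` ?S)" by (rule chart_open_preimage[OF c(1)])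
  moreover have "p \<in> U \<inter> c -` ?S" using c assms(2) chart_inv[OF c] by simp
  moreover have "f q \<noteq> 0" if "q \<in> U \<inter> c -` ?S" for q
    using that chart_inv[OF c(1), of q] by simp
  ultimately show ?thesis by blast
qed

lemma smooth_extend_by_zero:
  assumes c: "(U, c) \<in> A" and S: "open S" "S \<subseteq> c ` U" and F: "smooth_on S F"
    and K: "compact K" "K \<subseteq> S" "\<And>y. y \<in> S - K \<Longrightarrow> F y = 0"
  shows "smooth (\<lambda>q. if q \<in> U \<and> c q \<in> S then F (c q) else 0)" (is "smooth ?f")
proof (rule smoothI, rule Ck_on_locally)
  fix V d k x assume d: "(V, d) \<in> A" and "x \<in> d ` V"
  let ?i = "inv_into V d" and ?P = "U \<inter> c -` S"
  obtain q where q: "q \<in> V" "x = d q" using \<open>x \<in> d ` V\<close> by blast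
  show "\<exists>T. open T \<and> x \<in> T \<and> Ck_on k T (?f \<circ> ?i)"
  proof (cases "q \<in> ?P")
    case True
    let ?T = "d ` (V \<inter> ?P)"
    have T: "open ?T" by (rule chart_open_image[OF d chart_open_preimage[OF c S(1)]])
    have "smooth_on (d ` (V \<inter> U)) (c \<circ> ?i)"
      using atlas c d unfolding smooth_atlas_def by blast
    then have "Ck_on k ?T (c \<circ> ?i)"
      unfolding smooth_on_def by (auto intro: Ck_on_subset)
    then have "Ck_on k ?T (\<lambda>y. F ((c \<circ> ?i) y))"
      using F by (intro Ck_on_compose[OF T S(1)]) (auto simp: smooth_on_def chart_inv[OF d] comp_def)
    then have "Ck_on k ?T (?f \<circ> ?i)"
      by (rule Ck_on_cong[OF T, rotated]) (auto simp: chart_inv[OF d])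
    with T True q show ?thesis by blast
  next
    case False
    \<comment> \<open>Hausdorff separation is essential here: it makes the compact set \<open>?K\<close> closed in the whole manifold.\<close>
    let ?K = "inv_into U c ` K"
    have "compact ?K"
      by (rule compact_continuous_image[OF continuous_on_subset[OF homeomorphism_cont2[OF chart_homeo(3)[OF c]]] K(1)])
         (use K S in auto)
    then have "closed ?K" by (rule compact_imp_closed)
    have KP: "?K \<subseteq> ?P" using K S chart_inv[OF c] by fastforce
    let ?T = "d ` (V \<inter> - ?K)"
    have T: "open ?T" by (rule chart_open_image[OF d]) (use \<open>closed ?K\<close> in auto)
    have z: "?f r = 0" if "r \<notin> ?K" for r
    proof (cases "r \<in> ?P")
      case True
      then have "c r \<notin> K" using that chart_inv[OF c, of r] by force
      then show ?thesis using True K(3) by auto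
    qed auto
    have "Ck_on k ?T (?f \<circ> ?i)"
    proof (rule Ck_on_cong[OF T _ Ck_on_const[OF T, of _ 0]])
      fix y assume "y \<in> ?T"
      then have "?i y \<notin> ?K" using chart_inv[OF d] by auto
      from z[OF this] show "0 = (?f \<circ> ?i) y" unfolding comp_def by (rule sym)
    qed
    moreover have "x \<in> ?T" using q False KP by blast
    ultimately show ?thesis using T by blast
  qed
qed

lemma bump_exists:
  assumes "open W" "p \<in> W"
  shows "\<exists>\<kappa>. smooth \<kappa> \<and> \<kappa> p = 1 \<and> (\<forall>q. q \<notin> W \<longrightarrow> \<kappa> q = 0)"
proof -
  obtain U c where c: "(U, c) \<in> A" "p \<in> U" using chart_at by blast
  let ?S = "c ` (U \<inter> W)"
  have S: "open ?S" by (rule chart_open_image[OF c(1) assms(1)])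
  obtain e where e: "e > 0" "ball (c p) e \<subseteq> ?S"
    using openE[OF S, of "c p"] c assms by blast
  define r where "r = e / 3"
  have r: "r > 0" "cball (c p) (2*r) \<subseteq> ?S" using e by (auto simp: r_def)
  obtain \<beta> :: "'e \<Rightarrow> real" where \<beta>: "smooth_on UNIV \<beta>" "\<And>y. y \<in> cball (c p) r \<Longrightarrow> \<beta> y = 1"
    "\<And>y. y \<notin> ball (c p) (2*r) \<Longrightarrow> \<beta> y = 0" using smooth_bump_exists[OF r(1)] by metis
  let ?\<kappa> = "\<lambda>q. if q \<in> U \<and> c q \<in> ?S then \<beta> (c q) else 0"
  show ?thesis
  proof (intro exI conjI allI impI)
    show "smooth ?\<kappa>"
      by (rule smooth_extend_by_zero[OF c(1) S _ _ compact_cball r(2)])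
         (use \<beta> in \<open>auto simp: smooth_on_def intro: Ck_on_subset\<close>)
    show "?\<kappa> p = 1" using c r(1) assms(2) \<beta>(2)[of "c p"] by auto
    show "?\<kappa> q = 0" if "q \<notin> W" for q
    proof -
      have "\<not> (q \<in> U \<and> c q \<in> ?S)"
        using that chart_inv[OF c(1)] by (metis Int_iff image_iff)
      then show ?thesis by auto
    qed
  qed
qed

lemma
  assumes "v \<in> T p"
  shows T_add: "smooth f \<Longrightarrow> smooth h \<Longrightarrow> v (\<lambda>q. f q + h q) = v f + v h"
    and T_scale: "smooth f \<Longrightarrow> v (\<lambda>q. k * f q) = k * v f"
    and T_mult: "smooth f \<Longrightarrow> smooth h \<Longrightarrow> v (\<lambda>q. f q * h q) = f p * v h + h p * v f"
    and T_nonsmooth: "\<not> smooth f \<Longrightarrow> v f = 0"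
  using assms unfolding tangent_space_def by auto

lemma T_const: "v \<in> T p \<Longrightarrow> v (\<lambda>_. k) = 0"
  using T_mult[of v p "\<lambda>_. 1" "\<lambda>_. 1"] T_scale[of v p "\<lambda>_. 1" k] by simp

lemma T_diff: "v \<in> T p \<Longrightarrow> smooth f \<Longrightarrow> smooth h \<Longrightarrow> v (\<lambda>q. f q - h q) = v f - v h"
  using T_add[of v p f "\<lambda>q. -1 * h q"] T_scale[of v p h "-1"] by (simp add: smooth_minus)

lemma T_sum:
  "v \<in> T p \<Longrightarrow> (\<And>i. i \<in> I \<Longrightarrow> smooth (f i)) \<Longrightarrow> v (\<lambda>q. \<Sum>i\<in>I. f i q) = (\<Sum>i\<in>I. v (f i))"
  proof (induction I rule: infinite_finite_induct)
  case (insert j I)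
  then have "v (\<lambda>q. f j q + (\<Sum>i\<in>I. f i q)) = v (f j) + v (\<lambda>q. \<Sum>i\<in>I. f i q)"
    by (intro T_add smooth_sum) auto
  with insert show ?case by simp
qed (simp_all add: T_const)

lemma chart_derivative:
  assumes c: "(U, c) \<in> A" and "q \<in> U" "smooth f"
  shows "(f \<circ> inv_into U c has_derivative frechet_derivative (f \<circ> inv_into U c) (at (c q))) (at (c q))"
  by (rule Ck_on_Suc_has_derivative[OF smooth_Ck[OF assms(3) c, of "Suc 0"]]) (use assms in auto)

text \<open>The \<open>i\<close>-th coordinate derivation of a chart, damped by \<open>\<beta>\<close>, which is to vanish near the boundary
  of the chart so that the field extends to the whole manifold. A tangent vector has to vanish on
  non-smooth functions, hence the case distinction.\<close>

definition coord_field :: "'a set \<Rightarrow> ('a \<Rightarrow> 'e) \<Rightarrow> ('e \<Rightarrow> real) \<Rightarrow> 'e \<Rightarrow> 'a vfield" where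
  "coord_field U c \<beta> i = (\<lambda>q f. if q \<in> U \<and> smooth f
     then \<beta> (c q) * frechet_derivative (f \<circ> inv_into U c) (at (c q)) i else 0)"

lemma coord_field_tangent:
  assumes c: "(U, c) \<in> A"
  shows "coord_field U c \<beta> i q \<in> T q"
proof (cases "q \<in> U")
  case True
  let ?i = "inv_into U c"
  note d = chart_derivative[OF c True]
  have add: "frechet_derivative ((\<lambda>q. f q + h q) \<circ> ?i) (at (c q)) i
      = frechet_derivative (f \<circ> ?i) (at (c q)) i + frechet_derivative (h \<circ> ?i) (at (c q)) i"
    if "smooth f" "smooth h" for f h
    using frechet_derivative_at[OF has_derivative_add[OF d[OF that(1)] d[OF that(2)]]]
    by (simp add: comp_def) metis
  have mult: "frechet_derivative ((\<lambda>q. f q * h q) \<circ> ?i) (at (c q)) i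
      = f q * frechet_derivative (h \<circ> ?i) (at (c q)) i + h q * frechet_derivative (f \<circ> ?i) (at (c q)) i"
    if "smooth f" "smooth h" for f h
    using fun_cong[OF frechet_derivative_at[OF has_derivative_mult[OF d[OF that(1)] d[OF that(2)]]], of i]
      chart_inv[OF c True]
    by (simp add: comp_def mult.commute)
  have const: "frechet_derivative ((\<lambda>q. k) \<circ> ?i) (at (c q)) i = 0" for k
    by (simp add: comp_def)
  show ?thesis
    unfolding tangent_space_def coord_field_def
    using add mult mult[OF smooth_const] const
    by (auto simp: True smooth_add smooth_mult algebra_simps)
qed (auto simp: tangent_space_def coord_field_def)

text \<open>Globally defined fields and functions which, over \<open>W\<close>, are a frame and dual coordinate functions;
  being global, they can be inserted into the connection and the curvature directly.\<close>

definition local_frame :: "'a set \<Rightarrow> ('e \<Rightarrow> 'a \<Rightarrow> real) \<Rightarrow> ('e \<Rightarrow> 'a vfield) \<Rightarrow> bool" where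
  "local_frame W x E \<longleftrightarrow> open W \<and> (\<forall>i. smooth (x i)) \<and> (\<forall>i. VF (E i)) \<and>
     (\<forall>q\<in>W. \<forall>i\<in>Basis. \<forall>j\<in>Basis. E i q (x j) = (if i = j then 1 else 0)) \<and>
     (\<forall>q\<in>W. \<forall>v\<in>T q. v = (\<Sum>i\<in>Basis. v (x i) *\<^sub>T E i q))"

text \<open>The fields are damped coordinate derivations and the functions damped coordinates. To expand a
  derivation \<open>v\<close> at \<open>q\<close>, Hadamard's formula writes a smooth \<open>f\<close> near \<open>q\<close> as a constant plus a sum of
  products of coordinate differences and smooth functions; after multiplication with the square of
  a bump function the identity holds globally, and the Leibniz rule evaluates both sides.\<close>

lemma local_frame_exists: "\<exists>W x E. p \<in> W \<and> local_frame W x E"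
proof -
  obtain U c where c: "(U, c) \<in> A" "p \<in> U" using chart_at by blast
  let ?i = "inv_into U c" and ?S = "c ` U"
  have S: "open ?S" by (rule chart_homeo[OF c(1)])
  obtain e where e: "e > 0" "ball (c p) e \<subseteq> ?S"
    using openE[OF S, of "c p"] c by blast
  define r where "r = e / 3"
  have r: "r > 0" "cball (c p) (2*r) \<subseteq> ?S" using e by (auto simp: r_def)
  obtain \<beta> :: "'e \<Rightarrow> real" where \<beta>: "smooth_on UNIV \<beta>" "\<And>y. y \<in> cball (c p) r \<Longrightarrow> \<beta> y = 1"
    "\<And>y. y \<notin> ball (c p) (2*r) \<Longrightarrow> \<beta> y = 0" using smooth_bump_exists[OF r(1)] by metis
  have \<beta>0: "\<beta> y = 0" if "y \<in> ?S - cball (c p) (2*r)" for y using \<beta>(3) that by auto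
  have Ck\<beta>: "Ck_on k X \<beta>" for k X using \<beta>(1) Ck_on_subset unfolding smooth_on_def by blast
  note ext = smooth_extend_by_zero[OF c(1) S subset_refl _ compact_cball r(2)]
  define x where "x = (\<lambda>i q. if q \<in> U \<and> c q \<in> ?S then \<beta> (c q) * (c q \<bullet> i) else 0)"
  define E where "E = coord_field U c \<beta>"
  define W where "W = U \<inter> c -` ball (c p) r"
  have xW: "x i q = c q \<bullet> i" if "q \<in> W" for i q
    using that \<beta>(2)[of "c q"] by (auto simp: W_def x_def)
  have sx: "smooth (x i)" for i
    unfolding x_def using \<beta>0
    by (intro ext) (auto simp: smooth_on_def
        intro!: Ck_on_mult[OF S Ck\<beta> Ck_on_bounded_linear[OF S bounded_linear_inner_left]])
  have E: "VF (E i)" for i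
    unfolding vector_field_def
  proof (intro conjI allI impI)
    show "E i q \<in> T q" for q unfolding E_def by (rule coord_field_tangent[OF c(1)])
    fix f assume f: "smooth f"
    have D: "Ck_on k ?S (\<lambda>y. frechet_derivative (f \<circ> ?i) (at y) i)" for k
      using smooth_Ck[OF f c(1), of "Suc k"] by auto
    have "smooth (\<lambda>q. if q \<in> U \<and> c q \<in> ?S then \<beta> (c q) * frechet_derivative (f \<circ> ?i) (at (c q)) i else 0)"
    proof (rule ext)
      show "smooth_on ?S (\<lambda>y. \<beta> y * frechet_derivative (f \<circ> ?i) (at y) i)"
        unfolding smooth_on_def by (intro allI Ck_on_mult[OF S Ck\<beta> D])
    qed (simp add: \<beta>0)
    also have "(\<lambda>q. if q \<in> U \<and> c q \<in> ?S then \<beta> (c q) * frechet_derivative (f \<circ> ?i) (at (c q)) i else 0)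
        = (\<lambda>q. E i q f)"
      using f by (auto simp: E_def coord_field_def)
    finally show "smooth (\<lambda>q. E i q f)" .
  qed
  have EW: "E i q f = frechet_derivative (f \<circ> ?i) (at (c q)) i" if "q \<in> W" "smooth f" for i q f
    using that \<beta>(2)[of "c q"] by (auto simp: W_def E_def coord_field_def)
  have Wopen: "open W" unfolding W_def by (rule chart_open_preimage[OF c(1)]) auto
  have dual: "E i q (x j) = (if i = j then 1 else 0)"
    if q: "q \<in> W" and ij: "i \<in> Basis" "j \<in> Basis" for q i j
  proof -
    have "((\<lambda>y. y \<bullet> j) has_derivative (\<lambda>v. v \<bullet> j)) (at (c q))"
      by (auto intro!: derivative_eq_intros)
    then have "((x j \<circ> ?i) has_derivative (\<lambda>v. v \<bullet> j)) (at (c q))"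
    proof (rule has_derivative_transform_within_open[OF _ chart_open_image[OF c(1) Wopen]])
      show "c q \<in> c ` (U \<inter> W)" using q by (auto simp: W_def)
      show "y \<bullet> j = (x j \<circ> ?i) y" if "y \<in> c ` (U \<inter> W)" for y
        using that xW chart_inv[OF c(1)] by auto
    qed
    then have "E i q (x j) = i \<bullet> j"
      using EW[OF q sx] frechet_derivative_at by metis
    then show ?thesis using ij by (simp add: inner_Basis)
  qed
  have rep: "v f = (\<Sum>i\<in>Basis. v (x i) * E i q f)"
    if q: "q \<in> W" and v: "v \<in> T q" and f: "smooth f" for q v f
  proof -
    define a where "a = c q"
    have qU: "q \<in> U" using q W_def by auto
    have "open (ball (c p) r)" "a \<in> ball (c p) r" using q by (auto simp: W_def a_def)
    then obtain \<rho> where \<rho>: "\<rho> > 0" "ball a \<rho> \<subseteq> ball (c p) r" using openE by blast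
    let ?B = "ball a \<rho>"
    have BS: "?B \<subseteq> ?S" using \<rho>(2) r by force
    have fB: "smooth_on ?B (f \<circ> ?i)"
      unfolding smooth_on_def using smooth_Ck[OF f c(1)] BS Ck_on_subset by blast
    obtain h where h: "\<forall>i. smooth_on ?B (h i)"
      "\<forall>i. h i a = frechet_derivative (f \<circ> ?i) (at a) i"
      "\<forall>y\<in>?B. (f \<circ> ?i) y = (f \<circ> ?i) a + (\<Sum>i\<in>Basis. ((y - a) \<bullet> i) * h i y)"
      using hadamard[OF fB \<rho>(1)] by blast
    define s where "s = \<rho> / 3"
    have s: "s > 0" "cball a (2 * s) \<subseteq> ?B" using \<rho> by (auto simp: s_def)
    obtain \<gamma> :: "'e \<Rightarrow> real" where \<gamma>: "smooth_on UNIV \<gamma>" "\<And>y. y \<in> cball a s \<Longrightarrow> \<gamma> y = 1"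
      "\<And>y. y \<notin> ball a (2 * s) \<Longrightarrow> \<gamma> y = 0" using smooth_bump_exists[OF s(1)] by metis
    have \<gamma>0: "\<gamma> y = 0" if "y \<in> ?B - cball a (2 * s)" for y using \<gamma>(3) that by auto
    have Ck\<gamma>: "Ck_on k X \<gamma>" for k X using \<gamma>(1) Ck_on_subset unfolding smooth_on_def by blast
    note ext2 = smooth_extend_by_zero[OF c(1) open_ball BS _ compact_cball s(2)]
    let ?e = "\<lambda>F q. if q \<in> U \<and> c q \<in> ?B then F (c q) else (0::real)"
    let ?\<kappa> = "?e \<gamma>"
    let ?H = "\<lambda>i. ?e (\<lambda>y. \<gamma> y * h i y)"
    have s\<kappa>: "smooth ?\<kappa>" using \<gamma>0 by (intro ext2) (auto simp: smooth_on_def Ck\<gamma>)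
    have sH: "smooth (?H i)" for i
    proof (rule ext2)
      show "smooth_on ?B (\<lambda>y. \<gamma> y * h i y)"
        using h(1) unfolding smooth_on_def by (intro allI Ck_on_mult[OF open_ball Ck\<gamma>]) auto
    qed (simp add: \<gamma>0)
    obtain \<kappa> H where \<kappa>H: "\<kappa> = ?\<kappa>" "H = ?H" by blast
    have s\<kappa>: "smooth \<kappa>" and sH: "smooth (H i)" for i using s\<kappa> sH[of i] by (simp_all only: \<kappa>H)
    have \<kappa>q: "\<kappa> q = 1" using qU \<gamma>(2)[of a] s \<rho> by (auto simp: a_def \<kappa>H)
    have Hq: "H i q = E i q f" for i
      using EW[OF q f] h(2) \<gamma>(2)[of a] s \<rho> qU by (auto simp: a_def \<kappa>H)
    let ?y = "\<lambda>i q'. \<kappa> q' * (x i q' - x i q)"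
    have sy: "smooth (?y i)" for i by (intro smooth_mult smooth_diff s\<kappa> sx smooth_const)
    have vy: "v (?y i) = v (x i)" for i
      by (subst T_mult[OF v s\<kappa> smooth_diff[OF sx smooth_const]])
         (simp add: \<kappa>q T_diff[OF v sx smooth_const] T_const[OF v])
    \<comment> \<open>One factor \<open>\<kappa>\<close> globalizes the coordinate difference, the other one Hadamard's coefficient.\<close>
    have eq: "\<kappa> q' * \<kappa> q' * f q' = \<kappa> q' * \<kappa> q' * f q + (\<Sum>i\<in>Basis. ?y i q' * H i q')" for q'
    proof (cases "q' \<in> U \<and> c q' \<in> ?B")
      case True
      then have qW: "q' \<in> W" using \<rho>(2) by (auto simp: W_def)
      have fq': "f q' = f q + (\<Sum>i\<in>Basis. ((c q' - a) \<bullet> i) * h i (c q'))"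
        using bspec[OF h(3), of "c q'"] True chart_inv[OF c(1)] qU by (auto simp: a_def)
      have term_eq: "?y i q' * H i q' = \<gamma> (c q') * \<gamma> (c q') * (((c q' - a) \<bullet> i) * h i (c q'))" for i
        using True by (simp add: xW[OF qW] xW[OF q] a_def inner_diff_left \<kappa>H)
      have "\<kappa> q' = \<gamma> (c q')" using True by (simp add: \<kappa>H)
      then show ?thesis unfolding term_eq fq' by (simp only: sum_distrib_left distrib_left)
    qed (auto simp: \<kappa>H)
    have s\<kappa>2: "smooth (\<lambda>q'. \<kappa> q' * \<kappa> q')" by (intro smooth_mult s\<kappa>)
    have s2: "smooth (\<lambda>q'. ?y i q' * H i q')" for i by (rule smooth_mult[OF sy sH])
    have "v (\<lambda>q'. \<kappa> q' * \<kappa> q' * f q') = v (\<lambda>q'. \<kappa> q' * \<kappa> q' * f q + (\<Sum>i\<in>Basis. ?y i q' * H i q'))"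
      using eq by presburger
    also have "\<dots> = v (\<lambda>q'. \<kappa> q' * \<kappa> q' * f q) + (\<Sum>i\<in>Basis. v (\<lambda>q'. ?y i q' * H i q'))"
      by (subst T_add[OF v smooth_mult[OF s\<kappa>2 smooth_const] smooth_sum[OF s2]], subst T_sum[OF v s2]) auto
    finally have sum: "v (\<lambda>q'. \<kappa> q' * \<kappa> q' * f q')
        = v (\<lambda>q'. \<kappa> q' * \<kappa> q' * f q) + (\<Sum>i\<in>Basis. v (\<lambda>q'. ?y i q' * H i q'))" .
    have l: "v (\<lambda>q'. \<kappa> q' * \<kappa> q' * f q') = v f + f q * v (\<lambda>q'. \<kappa> q' * \<kappa> q')"
      by (subst T_mult[OF v s\<kappa>2 f]) (simp add: \<kappa>q)
    have r: "v (\<lambda>q'. \<kappa> q' * \<kappa> q' * f q) = f q * v (\<lambda>q'. \<kappa> q' * \<kappa> q')"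
      by (subst T_mult[OF v s\<kappa>2 smooth_const]) (simp add: T_const[OF v])
    have t: "v (\<lambda>q'. ?y i q' * H i q') = v (x i) * E i q f" for i
      by (subst T_mult[OF v sy sH]) (simp add: vy Hq)
    show ?thesis using sum unfolding l r t by simp
  qed
  have "local_frame W x E"
    unfolding local_frame_def
  proof (intro conjI allI ballI Wopen sx E dual)
    fix q v assume qv: "q \<in> W" "v \<in> T q"
    show "v = (\<Sum>i\<in>Basis. v (x i) *\<^sub>T E i q)"
    proof
      fix f
      show "v f = (\<Sum>i\<in>Basis. v (x i) *\<^sub>T E i q) f"
      proof (cases "smooth f")
        case False
        have "E i q f = 0" for i
          using E[of i] by (intro T_nonsmooth[of _ q, OF _ False]) (simp add: vector_field_def)
        then show ?thesis
          using T_nonsmooth[OF qv(2) False] by (simp add: sum_fun_apply tscale_def)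
      qed (use rep[OF qv, of f] in \<open>simp add: sum_fun_apply tscale_def\<close>)
    qed
  qed
  moreover have "p \<in> W" using c r by (auto simp: W_def)
  ultimately show ?thesis by blast
qed

lemma
  assumes "local_frame W x E"
  shows local_frame_open: "open W"
    and local_frame_smooth: "smooth (x i)"
    and local_frame_VF: "VF (E i)"
    and local_frame_dual: "q \<in> W \<Longrightarrow> i \<in> Basis \<Longrightarrow> j \<in> Basis \<Longrightarrow> E i q (x j) = (if i = j then 1 else 0)"
    and local_frame_expand: "q \<in> W \<Longrightarrow> v \<in> T q \<Longrightarrow> (\<Sum>i\<in>Basis. v (x i) *\<^sub>T E i q) = v"
proof -
  note F = assms[unfolded local_frame_def]
  show "open W" "smooth (x i)" "VF (E i)" using F by auto
  show "q \<in> W \<Longrightarrow> i \<in> Basis \<Longrightarrow> j \<in> Basis \<Longrightarrow> E i q (x j) = (if i = j then 1 else 0)" using F by blast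
  show "q \<in> W \<Longrightarrow> v \<in> T q \<Longrightarrow> (\<Sum>i\<in>Basis. v (x i) *\<^sub>T E i q) = v" using F by metis
qed

section \<open>Traces on tangent spaces and tensoriality\<close>

lemma T_zero: "0 \<in> T p"
  by (simp add: tangent_space_def)

lemma T_plus: "u \<in> T p \<Longrightarrow> v \<in> T p \<Longrightarrow> u + v \<in> T p"
  by (auto simp: tangent_space_def algebra_simps)

lemma T_tscale: "v \<in> T p \<Longrightarrow> k *\<^sub>T v \<in> T p"
  by (auto simp: tangent_space_def tscale_def algebra_simps)

lemma T_subspace: "tvec.subspace (T p)"
  by (simp add: tvec.subspace_def T_zero T_plus T_tscale)

lemmas T_uminus = tvec.subspace_neg[OF T_subspace]
lemmas T_minus = tvec.subspace_diff[OF T_subspace]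
lemmas T_setsum = tvec.subspace_sum[OF T_subspace]

lemma VF_T: "VF X \<Longrightarrow> X p \<in> T p"
  and VF_smooth: "VF X \<Longrightarrow> smooth f \<Longrightarrow> smooth (\<lambda>q. X q f)"
  by (auto simp: vector_field_def)

lemma VF_zero: "VF 0"
  using T_zero by (auto simp: vector_field_def)

lemma VF_add: "VF X \<Longrightarrow> VF Y \<Longrightarrow> VF (X + Y)"
  by (auto simp: vector_field_def T_plus smooth_add)

lemma VF_fmult: "smooth f \<Longrightarrow> VF X \<Longrightarrow> VF (f *\<^sub>F X)"
  by (auto simp: vector_field_def fmult_def T_tscale) (simp add: tscale_def smooth_mult)

lemma VF_uminus: "VF X \<Longrightarrow> VF (- X)"
  by (auto simp: vector_field_def T_uminus smooth_minus)

lemma VF_diff: "VF X \<Longrightarrow> VF Y \<Longrightarrow> VF (X - Y)"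
  using VF_add[OF _ VF_uminus, of X Y] by simp

lemma VF_sum: "(\<And>i. i \<in> I \<Longrightarrow> VF (X i)) \<Longrightarrow> VF (\<Sum>i\<in>I. X i)"
  by (induction I rule: infinite_finite_induct) (auto intro: VF_zero VF_add)

lemma extension_exists:
  assumes "v \<in> T p" obtains V where "VF V" "V p = v"
proof -
  obtain W x E where F: "p \<in> W" "local_frame W x E" using local_frame_exists by blast
  have "(\<Sum>i\<in>Basis. (\<lambda>_. v (x i)) *\<^sub>F E i) p = v"
    using local_frame_expand[OF F(2,1) assms] by (simp add: sum_fun_apply[where x = p] fmult_def)
  moreover have "VF (\<Sum>i\<in>Basis. (\<lambda>_. v (x i)) *\<^sub>F E i)"
    by (intro VF_sum VF_fmult smooth_const local_frame_VF[OF F(2)])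
  ultimately show thesis using that by blast
qed

lemma
  assumes "v \<in> T p"
  shows extend_VF: "VF (extend_tvec A p v)" and extend_at: "extend_tvec A p v p = v"
proof -
  have "\<exists>V. VF V \<and> V p = v" using extension_exists[OF assms] by blast
  from someI_ex[OF this] show "VF (extend_tvec A p v)" "extend_tvec A p v p = v"
    by (auto simp: extend_tvec_def)
qed

definition lin_on :: "'a \<Rightarrow> ('a tvec \<Rightarrow> real) \<Rightarrow> bool" where
  "lin_on p \<alpha> \<longleftrightarrow> (\<forall>u\<in>T p. \<forall>v\<in>T p. \<alpha> (u + v) = \<alpha> u + \<alpha> v) \<and> (\<forall>k. \<forall>v\<in>T p. \<alpha> (k *\<^sub>T v) = k * \<alpha> v)"

lemma lin_on_sum:
  assumes "lin_on p \<alpha>" "\<And>b. b \<in> S \<Longrightarrow> f b \<in> T p"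
  shows "\<alpha> (\<Sum>b\<in>S. k b *\<^sub>T f b) = (\<Sum>b\<in>S. k b * \<alpha> (f b))"
proof -
  have 0: "\<alpha> 0 = 0" using assms(1) T_zero unfolding lin_on_def
    by (metis mult_zero_left tvec.scale_zero_left)
  show ?thesis using assms(2)
  proof (induction S rule: infinite_finite_induct)
    case (insert b S)
    then have "(\<Sum>b\<in>S. k b *\<^sub>T f b) \<in> T p" by (intro T_setsum T_tscale) auto
    then have "\<alpha> (k b *\<^sub>T f b + (\<Sum>b\<in>S. k b *\<^sub>T f b)) = k b * \<alpha> (f b) + \<alpha> (\<Sum>b\<in>S. k b *\<^sub>T f b)"
      using assms(1) insert.prems[of b] T_tscale unfolding lin_on_def by (metis insertI1)
    then show ?case using insert.IH insert.prems by (simp only: sum.insert[OF insert.hyps] insertI2)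
  qed (simp_all add: 0)
qed

lemma tangent_basis:
  obtains B where "tvec.independent B" "tvec.span B = T p" "finite B" "card B = DIM('e)"
proof -
  obtain W x E where F: "p \<in> W" "local_frame W x E" using local_frame_exists by blast
  note dual = local_frame_dual[OF F(2,1)]
  let ?E = "\<lambda>i. E i p"
  let ?B = "?E ` Basis"
  have inj: "inj_on ?E Basis"
    by (rule inj_onI) (metis dual zero_neq_one)
  have indep: "k b = 0" if z: "(\<Sum>b\<in>?B. k b *\<^sub>T b) = 0" and "b \<in> ?B" for k b
  proof -
    obtain j where j: "j \<in> Basis" "b = ?E j" using \<open>b \<in> ?B\<close> by blast
    have "0 = (\<Sum>b\<in>?B. k b *\<^sub>T b) (x j)" using z by simp
    also have "\<dots> = (\<Sum>i\<in>Basis. k (?E i) * (if i = j then 1 else 0))"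
      using dual j by (simp add: sum.reindex[OF inj] sum_fun_apply tscale_def)
    also have "\<dots> = k b" using j by (simp add: if_distrib cong: if_cong)
    finally show ?thesis by simp
  qed
  have ind: "tvec.independent ?B"
    using indep by (subst tvec.dependent_finite) auto
  have span: "tvec.span ?B = T p"
  proof
    show "tvec.span ?B \<subseteq> T p"
      by (rule tvec.span_minimal[OF _ T_subspace]) (use local_frame_VF[OF F(2)] VF_T in blast)
    show "T p \<subseteq> tvec.span ?B"
    proof
      fix v assume "v \<in> T p"
      have "(\<Sum>i\<in>Basis. v (x i) *\<^sub>T E i p) \<in> tvec.span ?B"
        by (intro tvec.span_sum tvec.span_scale tvec.span_base) auto
      then show "v \<in> tvec.span ?B" using local_frame_expand[OF F(2,1) \<open>v \<in> T p\<close>] by simp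
    qed
  qed
  show thesis by (rule that[OF ind span]) (simp_all add: card_image[OF inj])
qed

text \<open>The basis chosen in the definition of the trace has the expected size, by comparison with the
  basis given by a local frame.\<close>

lemma tangent_trace_basis:
  "\<exists>B. tvec.independent B \<and> tvec.span B = T p \<and> finite B \<and> card B = DIM('e) \<and> B \<subseteq> T p \<and>
     (\<forall>F. tangent_trace A p F = (\<Sum>b\<in>B. tvec.representation B (F b) b))"
proof -
  define B where "B = (SOME B. tvec.independent B \<and> tvec.span B = T p)"
  obtain B' where B': "tvec.independent B'" "tvec.span B' = T p" "finite B'" "card B' = DIM('e)"
    using tangent_basis .
  then have "tvec.independent B \<and> tvec.span B = T p"
    unfolding B_def by (metis (mono_tags, lifting) someI_ex)
  then have B: "tvec.independent B" "tvec.span B = T p" by auto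
  have sub: "B \<subseteq> T p" using B(2) tvec.span_superset by blast
  have "finite B \<and> card B \<le> card B'"
    by (rule tvec.independent_span_bound) (use B B' sub in auto)
  moreover have "B' \<subseteq> tvec.span B" using B B' tvec.span_superset by blast
  then have "finite B \<Longrightarrow> card B' \<le> card B"
    using tvec.independent_span_bound[of B B'] B' by auto
  ultimately show ?thesis
    by (intro exI[of _ B]) (simp add: B sub B'(4) tangent_trace_def B_def[symmetric] Let_def)
qed

lemma trace_cong:
  assumes "\<And>v. v \<in> T p \<Longrightarrow> F v = G v"
  shows "tangent_trace A p F = tangent_trace A p G"
proof -
  obtain B where B: "B \<subseteq> T p"
    "\<forall>F. tangent_trace A p F = (\<Sum>b\<in>B. tvec.representation B (F b) b)"
    using tangent_trace_basis[of p] by blast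
  have "F b = G b" if "b \<in> B" for b using assms B(1) that by blast
  then show ?thesis by (simp add: B(2))
qed

lemma trace_add:
  assumes "\<And>v. v \<in> T p \<Longrightarrow> F v \<in> T p" "\<And>v. v \<in> T p \<Longrightarrow> G v \<in> T p"
  shows "tangent_trace A p (\<lambda>v. F v + G v) = tangent_trace A p F + tangent_trace A p G"
proof -
  obtain B where B: "tvec.independent B" "tvec.span B = T p" "B \<subseteq> T p"
    "\<forall>F. tangent_trace A p F = (\<Sum>b\<in>B. tvec.representation B (F b) b)"
    using tangent_trace_basis[of p] by blast
  have "tvec.representation B (F b + G b) b = tvec.representation B (F b) b + tvec.representation B (G b) b"
    if "b \<in> B" for b
    using tvec.representation_add[OF B(1)] assms B that by auto
  then show ?thesis by (simp add: B(4) sum.distrib)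
qed

lemma trace_scale:
  assumes "\<And>v. v \<in> T p \<Longrightarrow> F v \<in> T p"
  shows "tangent_trace A p (\<lambda>v. k *\<^sub>T F v) = k * tangent_trace A p F"
proof -
  obtain B where B: "tvec.independent B" "tvec.span B = T p" "B \<subseteq> T p"
    "\<forall>F. tangent_trace A p F = (\<Sum>b\<in>B. tvec.representation B (F b) b)"
    using tangent_trace_basis[of p] by blast
  have "tvec.representation B (k *\<^sub>T F b) b = k * tvec.representation B (F b) b" if "b \<in> B" for b
    using tvec.representation_scale[OF B(1)] assms B that by auto
  then show ?thesis by (simp add: B(4) sum_distrib_left)
qed

text \<open>Every endomorphism whose trace the Kenmotsu computation evaluates has this form; its trace can be
  read off in whichever basis the definition chooses.\<close>

lemma trace_rank_one_plus_scalar: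
  assumes \<alpha>: "lin_on p \<alpha>" and w: "w \<in> T p"
    and F: "\<And>v. v \<in> T p \<Longrightarrow> F v = \<alpha> v *\<^sub>T w + c *\<^sub>T v"
  shows "tangent_trace A p F = \<alpha> w + c * DIM('e)"
proof -
  obtain B where B: "tvec.independent B" "tvec.span B = T p" "finite B" "card B = DIM('e)" "B \<subseteq> T p"
    "\<forall>F. tangent_trace A p F = (\<Sum>b\<in>B. tvec.representation B (F b) b)"
    using tangent_trace_basis[of p] by blast
  let ?r = "tvec.representation B"
  have "?r (F b) b = ?r w b * \<alpha> b + c" if b: "b \<in> B" for b
  proof -
    have bT: "b \<in> T p" using b B by auto
    then have "?r (F b) b = \<alpha> b * ?r w b + c * ?r b b"
      using w by (simp add: F tvec.representation_add[OF B(1)] tvec.representation_scale[OF B(1)] B(2) T_tscale)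
    then show ?thesis using tvec.representation_basis[OF B(1) b] by simp
  qed
  then have "tangent_trace A p F = (\<Sum>b\<in>B. ?r w b * \<alpha> b) + c * DIM('e)"
    by (simp add: B(4,6) sum.distrib)
  also have "(\<Sum>b\<in>B. ?r w b * \<alpha> b) = \<alpha> (\<Sum>b\<in>B. ?r w b *\<^sub>T b)"
    by (rule lin_on_sum[OF \<alpha>, symmetric]) (use B(5) in blast)
  also have "(\<Sum>b\<in>B. ?r w b *\<^sub>T b) = w"
    by (rule tvec.sum_representation_eq[OF B(1)]) (use w B in auto)
  finally show ?thesis .
qed

text \<open>Invariance of the trace under change of basis, needed for its smooth dependence on the point.\<close>

lemma trace_frame:
  assumes F: "\<And>v. v \<in> T p \<Longrightarrow> F v \<in> T p" "\<And>f. lin_on p (\<lambda>v. F v f)"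
    and E: "\<And>i. i \<in> I \<Longrightarrow> E i \<in> T p" "\<And>v. v \<in> T p \<Longrightarrow> (\<Sum>i\<in>I. v (x i) *\<^sub>T E i) = v"
  shows "tangent_trace A p F = (\<Sum>i\<in>I. F (E i) (x i))"
proof -
  obtain B where B: "tvec.independent B" "tvec.span B = T p" "finite B" "B \<subseteq> T p"
    "\<forall>F. tangent_trace A p F = (\<Sum>b\<in>B. tvec.representation B (F b) b)"
    using tangent_trace_basis[of p] by blast
  let ?r = "tvec.representation B"
  have "?r (F b) b = (\<Sum>i\<in>I. ?r (E i) b * F b (x i))" if b: "b \<in> B" for b
  proof -
    have "?r (\<Sum>i\<in>I. F b (x i) *\<^sub>T E i) b = (\<Sum>i\<in>I. ?r (F b (x i) *\<^sub>T E i) b)"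
      by (subst tvec.representation_sum[OF B(1)]) (use B E T_tscale in \<open>auto simp: sum_fun_apply\<close>)
    also have "\<dots> = (\<Sum>i\<in>I. ?r (E i) b * F b (x i))"
      by (intro sum.cong refl) (use tvec.representation_scale[OF B(1)] E B in auto)
    finally show ?thesis using E(2)[OF F(1), of b] b B(4) by (simp add: subsetD)
  qed
  then have "tangent_trace A p F = (\<Sum>i\<in>I. \<Sum>b\<in>B. ?r (E i) b * F b (x i))"
    by (simp add: B(5)) (rule sum.swap)
  also have "\<dots> = (\<Sum>i\<in>I. F (\<Sum>b\<in>B. ?r (E i) b *\<^sub>T b) (x i))"
    by (intro sum.cong refl lin_on_sum[OF F(2), symmetric]) (use B(4) in blast)
  also have "\<dots> = (\<Sum>i\<in>I. F (E i) (x i))"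
    using tvec.sum_representation_eq[OF B(1) _ B(3), of _] E B(2) by (intro sum.cong) auto
  finally show ?thesis .
qed

text \<open>The value at \<open>p\<close> of a map between vector fields that is linear over the smooth functions.\<close>

definition tensorial_at :: "'a \<Rightarrow> ('a vfield \<Rightarrow> 'a tvec) \<Rightarrow> bool" where
  "tensorial_at p \<Phi> \<longleftrightarrow> (\<forall>X Y. VF X \<longrightarrow> VF Y \<longrightarrow> \<Phi> (X + Y) = \<Phi> X + \<Phi> Y) \<and>
     (\<forall>f X. smooth f \<longrightarrow> VF X \<longrightarrow> \<Phi> (f *\<^sub>F X) = f p *\<^sub>T \<Phi> X)"

text \<open>A bump function makes the local expansion of \<open>Z\<close> in a frame global, and linearity over smooth
  functions turns it into a combination of \<open>\<Phi> (E i)\<close> whose coefficients vanish at \<open>p\<close>.\<close>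

lemma tensorial_at_zero:
  assumes \<Phi>: "tensorial_at p \<Phi>" and Z: "VF Z" "Z p = 0"
  shows "\<Phi> Z = 0"
proof -
  obtain W x E where F: "p \<in> W" "local_frame W x E" using local_frame_exists by blast
  obtain \<kappa> where \<kappa>: "smooth \<kappa>" "\<kappa> p = 1" "\<forall>q. q \<notin> W \<longrightarrow> \<kappa> q = 0"
    using bump_exists[OF local_frame_open[OF F(2)] F(1)] by blast
  let ?f = "\<lambda>i q. \<kappa> q * Z q (x i)"
  have sf: "smooth (?f i)" for i by (rule smooth_mult[OF \<kappa>(1) VF_smooth[OF Z(1) local_frame_smooth[OF F(2)]]])
  have \<Phi>0: "\<Phi> 0 = 0"
  proof -
    have "\<Phi> (0 + 0) = \<Phi> 0 + \<Phi> 0" using \<Phi> VF_zero unfolding tensorial_at_def by blast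
    then show ?thesis by simp
  qed
  have "\<Phi> (\<Sum>i\<in>I. ?f i *\<^sub>F E i) = (\<Sum>i\<in>I. ?f i p *\<^sub>T \<Phi> (E i))" for I
  proof (induction I rule: infinite_finite_induct)
    case (insert i I)
    have "VF (?f i *\<^sub>F E i)" "VF (\<Sum>i\<in>I. ?f i *\<^sub>F E i)" by (intro VF_sum VF_fmult sf local_frame_VF[OF F(2)])+
    then have "\<Phi> (?f i *\<^sub>F E i + (\<Sum>i\<in>I. ?f i *\<^sub>F E i)) = ?f i p *\<^sub>T \<Phi> (E i) + \<Phi> (\<Sum>i\<in>I. ?f i *\<^sub>F E i)"
      using \<Phi> sf[of i] local_frame_VF[OF F(2), of i] unfolding tensorial_at_def by simp
    then show ?case using insert.IH by (simp only: sum.insert[OF insert.hyps])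
  qed (simp_all only: sum.infinite sum.empty \<Phi>0 not_False_eq_True)
  also have "(\<Sum>i\<in>Basis. ?f i *\<^sub>F E i) = \<kappa> *\<^sub>F Z"
  proof
    fix q
    show "(\<Sum>i\<in>Basis. ?f i *\<^sub>F E i) q = (\<kappa> *\<^sub>F Z) q"
    proof (cases "q \<in> W")
      case True
      have "(\<kappa> *\<^sub>F Z) q = \<kappa> q *\<^sub>T (\<Sum>i\<in>Basis. Z q (x i) *\<^sub>T E i q)"
        using local_frame_expand[OF F(2) True VF_T[OF Z(1)]] by (simp add: fmult_def)
      then show ?thesis by (simp add: sum_fun_apply fmult_def tvec.scale_sum_right)
    qed (simp add: sum_fun_apply fmult_def \<kappa>(3))
  qed
  finally have "\<Phi> (\<kappa> *\<^sub>F Z) = 0" by (simp add: Z(2) zero_fun_def)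
  moreover have "\<Phi> (\<kappa> *\<^sub>F Z) = \<kappa> p *\<^sub>T \<Phi> Z" using \<Phi> \<kappa>(1) Z(1) unfolding tensorial_at_def by blast
  ultimately show ?thesis using \<kappa>(2) by simp
qed

lemma tensorial_at_cong:
  assumes \<Phi>: "tensorial_at p \<Phi>" and "VF X" "VF Y" "X p = Y p"
  shows "\<Phi> X = \<Phi> Y"
proof -
  have "\<Phi> (X - Y) = 0" by (rule tensorial_at_zero[OF \<Phi>]) (use assms in \<open>auto intro: VF_diff\<close>)
  moreover have "\<Phi> ((X - Y) + Y) = \<Phi> (X - Y) + \<Phi> Y"
    using \<Phi> assms VF_diff unfolding tensorial_at_def by blast
  ultimately show ?thesis by simp
qed

lemma tensorial_at_lin_on:
  assumes \<Phi>: "tensorial_at p \<Phi>"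
  shows "lin_on p (\<lambda>v. \<Phi> (extend_tvec A p v) f)"
proof -
  let ?e = "extend_tvec A p"
  have "\<Phi> (?e (u + v)) = \<Phi> (?e u) + \<Phi> (?e v)" if "u \<in> T p" "v \<in> T p" for u v
  proof -
    have "\<Phi> (?e (u + v)) = \<Phi> (?e u + ?e v)"
      by (rule tensorial_at_cong[OF \<Phi>]) (use that in \<open>auto simp: extend_VF extend_at T_plus VF_add\<close>)
    then show ?thesis using \<Phi> that extend_VF unfolding tensorial_at_def by metis
  qed
  moreover have "\<Phi> (?e (k *\<^sub>T u)) = k *\<^sub>T \<Phi> (?e u)" if "u \<in> T p" for u k
  proof -
    have "\<Phi> (?e (k *\<^sub>T u)) = \<Phi> ((\<lambda>_. k) *\<^sub>F ?e u)"
      by (rule tensorial_at_cong[OF \<Phi>])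
         (use that in \<open>auto simp: extend_VF extend_at T_tscale VF_fmult\<close>, simp add: fmult_def extend_at)
    then show ?thesis using \<Phi> that extend_VF smooth_const unfolding tensorial_at_def by metis
  qed
  ultimately show ?thesis by (auto simp: lin_on_def tscale_def)
qed

end

section \<open>Curvature of the Levi-Civita connection\<close>

locale levi_civita_manifold = smooth_manifold A
  for A :: "('a::{t2_space, second_countable_topology}, 'e::euclidean_space) chart set" +
  fixes g :: "'a \<Rightarrow> 'a tvec \<Rightarrow> 'a tvec \<Rightarrow> real"
    and nabla :: "'a vfield \<Rightarrow> 'a vfield \<Rightarrow> 'a vfield"
  assumes metric: "pseudo_riemannian_metric A g"
    and levi_civita: "levi_civita A g nabla"
begin

abbreviation "R \<equiv> curvature nabla"
abbreviation "Ric \<equiv> ricci A nabla"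
abbreviation "Q \<equiv> ricci_operator A g nabla"

lemma
  shows g_sym: "u \<in> T p \<Longrightarrow> v \<in> T p \<Longrightarrow> g p u v = g p v u"
    and g_add_left: "u \<in> T p \<Longrightarrow> v \<in> T p \<Longrightarrow> w \<in> T p \<Longrightarrow> g p (u + v) w = g p u w + g p v w"
    and g_scale_left: "u \<in> T p \<Longrightarrow> v \<in> T p \<Longrightarrow> g p (k *\<^sub>T u) v = k * g p u v"
    and g_nondegenerate: "u \<in> T p \<Longrightarrow> (\<And>v. v \<in> T p \<Longrightarrow> g p u v = 0) \<Longrightarrow> u = 0"
    and g_smooth: "VF X \<Longrightarrow> VF Y \<Longrightarrow> smooth (\<lambda>p. g p (X p) (Y p))"
  using metric unfolding pseudo_riemannian_metric_def by blast+

lemma g_add_right: "u \<in> T p \<Longrightarrow> v \<in> T p \<Longrightarrow> w \<in> T p \<Longrightarrow> g p w (u + v) = g p w u + g p w v"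
  using g_sym[of w p "u + v"] g_sym[of w p u] g_sym[of w p v] g_add_left T_plus by simp

lemma g_scale_right: "u \<in> T p \<Longrightarrow> v \<in> T p \<Longrightarrow> g p v (k *\<^sub>T u) = k * g p v u"
  using g_sym[of v p "k *\<^sub>T u"] g_sym[of v p u] g_scale_left T_tscale by simp

lemma g_diff_left: "u \<in> T p \<Longrightarrow> v \<in> T p \<Longrightarrow> w \<in> T p \<Longrightarrow> g p (u - v) w = g p u w - g p v w"
  using g_add_left[of "u - v" p v w] T_minus by simp

lemma g_diff_right: "u \<in> T p \<Longrightarrow> v \<in> T p \<Longrightarrow> w \<in> T p \<Longrightarrow> g p w (u - v) = g p w u - g p w v"
  using g_add_right[of "u - v" p v w] T_minus by simp

lemma g_uminus_left: "u \<in> T p \<Longrightarrow> v \<in> T p \<Longrightarrow> g p (- u) v = - g p u v"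
  using g_diff_left[of 0 p u v] g_diff_left[of u p u v] T_zero by simp

lemma g_eqI:
  "u \<in> T p \<Longrightarrow> v \<in> T p \<Longrightarrow> (\<And>w. w \<in> T p \<Longrightarrow> g p u w = g p v w) \<Longrightarrow> u = v"
  using g_nondegenerate[of "u - v" p] T_minus g_diff_left by force

lemma lin_on_g: "u \<in> T p \<Longrightarrow> lin_on p (g p u)"
  by (simp add: lin_on_def g_add_right g_scale_right)

text \<open>In the coordinates of a frame, \<open>w \<mapsto> g p w\<close> becomes an endomorphism of the model space; it is
  injective because the metric is nondegenerate, hence surjective. This is what makes the
  description defining the Ricci operator meaningful.\<close>

lemma riesz_exists:
  assumes \<alpha>: "lin_on p \<alpha>"
  shows "\<exists>w\<in>T p. \<forall>v\<in>T p. g p w v = \<alpha> v"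
proof -
  obtain W x E where F: "p \<in> W" "local_frame W x E" using local_frame_exists by blast
  let ?E = "\<lambda>i. E i p"
  have ET: "?E i \<in> T p" for i using local_frame_VF[OF F(2)] VF_T by blast
  define c where "c = (\<lambda>u::'e. \<Sum>j\<in>Basis. (u \<bullet> j) *\<^sub>T ?E j)"
  have cT: "c u \<in> T p" for u unfolding c_def by (intro T_setsum T_tscale ET)
  have c_coord: "c u (x j) = u \<bullet> j" if "j \<in> Basis" for u j
  proof -
    have "c u (x j) = (\<Sum>i\<in>Basis. (u \<bullet> i) * (if i = j then 1 else 0))"
      unfolding c_def sum_fun_apply tscale_def
      by (intro sum.cong refl) (simp only: local_frame_dual[OF F(2,1) _ that])
    also have "\<dots> = u \<bullet> j" using that by (simp add: if_distrib cong: if_cong)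
    finally show ?thesis .
  qed
  have c_add: "c (u + v) = c u + c v" for u v
    by (simp add: c_def inner_add_left tvec.scale_left_distrib sum.distrib)
  have c_scale: "c (k *\<^sub>R u) = k *\<^sub>T c u" for k u
    by (simp add: c_def tvec.scale_sum_right)
  define L where "L = (\<lambda>u. \<Sum>i\<in>Basis. g p (c u) (?E i) *\<^sub>R i)"
  have L_coord: "L u \<bullet> i = g p (c u) (?E i)" if "i \<in> Basis" for u i
    using that by (simp add: L_def inner_sum_left inner_Basis if_distrib cong: if_cong)
  have lin: "linear L"
    by (rule linearI) (simp_all add: L_def c_add c_scale g_add_left g_scale_left cT ET
        scaleR_left_distrib sum.distrib scaleR_sum_right)
  have detect: "g p w v = \<alpha>' v" if "w \<in> T p" "lin_on p \<alpha>'" "\<And>i. i \<in> Basis \<Longrightarrow> g p w (?E i) = \<alpha>' (?E i)" "v \<in> T p"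
    for w v \<alpha>'
  proof -
    have v: "v = (\<Sum>i\<in>Basis. v (x i) *\<^sub>T ?E i)" using local_frame_expand[OF F(2,1) that(4)] by simp
    show ?thesis
      by (subst v, subst (2) v)
         (simp only: lin_on_sum[OF lin_on_g[OF that(1)] ET] lin_on_sum[OF that(2) ET] that(3) cong: sum.cong)
  qed
  have "inj L"
  proof (rule linear_injective_0[OF lin, THEN iffD2], intro allI impI)
    fix u assume "L u = 0"
    then have "g p (c u) (?E i) = 0" if "i \<in> Basis" for i using L_coord[OF that, of u] by simp
    then have "c u = 0"
      using detect[OF cT, of "\<lambda>_. 0" u] by (intro g_nondegenerate[OF cT]) (simp add: lin_on_def)
    show "u = 0"
    proof (rule euclidean_eqI)
      fix j :: 'e assume "j \<in> Basis"
      from c_coord[OF this, of u] show "u \<bullet> j = 0 \<bullet> j"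
        unfolding \<open>c u = 0\<close> zero_fun_apply inner_zero_left by (rule sym)
    qed
  qed
  then have "surj L" using linear_injective_imp_surjective lin by blast
  then obtain u where u: "L u = (\<Sum>i\<in>Basis. \<alpha> (?E i) *\<^sub>R i)" by (metis surjD)
  have "g p (c u) (?E i) = \<alpha> (?E i)" if "i \<in> Basis" for i
    using L_coord[OF that, of u] that unfolding u
    by (simp add: inner_sum_left inner_Basis if_distrib cong: if_cong)
  then show ?thesis using detect[OF cT \<alpha>] cT by blast
qed

lemma
  assumes X: "VF X" and Y: "VF Y"
  shows nabla_VF: "VF (nabla X Y)"
    and nabla_add_left: "VF Z \<Longrightarrow> nabla (X + Y) Z = nabla X Z + nabla Y Z"
    and nabla_add_right: "VF Z \<Longrightarrow> nabla Z (X + Y) = nabla Z X + nabla Z Y"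
    and nabla_fmult_left: "smooth f \<Longrightarrow> nabla (f *\<^sub>F X) Y = f *\<^sub>F nabla X Y"
    and nabla_fmult_right: "smooth f \<Longrightarrow> nabla X (f *\<^sub>F Y) = (\<lambda>p. X p f) *\<^sub>F Y + f *\<^sub>F nabla X Y"
    and torsion_free: "nabla X Y - nabla Y X = lie_bracket X Y"
    and nabla_metric: "VF Z \<Longrightarrow> X p (\<lambda>q. g q (Y q) (Z q)) = g p (nabla X Y p) (Z p) + g p (Y p) (nabla X Z p)"
proof -
  note lc = levi_civita[unfolded levi_civita_def]
  note con = conjunct1[OF lc, unfolded affine_connection_def, rule_format, OF X Y]
  show "VF (nabla X Y)" "VF Z \<Longrightarrow> nabla (X + Y) Z = nabla X Z + nabla Y Z"
    "VF Z \<Longrightarrow> nabla Z (X + Y) = nabla Z X + nabla Z Y"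
    "smooth f \<Longrightarrow> nabla (f *\<^sub>F X) Y = f *\<^sub>F nabla X Y"
    "smooth f \<Longrightarrow> nabla X (f *\<^sub>F Y) = (\<lambda>p. X p f) *\<^sub>F Y + f *\<^sub>F nabla X Y"
    using con by simp_all
  show "nabla X Y - nabla Y X = lie_bracket X Y"
    using lc X Y by simp
  show "VF Z \<Longrightarrow> X p (\<lambda>q. g q (Y q) (Z q)) = g p (nabla X Y p) (Z p) + g p (Y p) (nabla X Z p)"
    using lc X Y by simp
qed

lemma nabla_diff_left: "VF X \<Longrightarrow> VF Y \<Longrightarrow> VF Z \<Longrightarrow> nabla (X - Y) Z = nabla X Z - nabla Y Z"
  using nabla_add_left[of "X - Y" Y Z] VF_diff by simp

lemma nabla_diff_right: "VF X \<Longrightarrow> VF Y \<Longrightarrow> VF Z \<Longrightarrow> nabla Z (X - Y) = nabla Z X - nabla Z Y"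
  using nabla_add_right[of "X - Y" Y Z] VF_diff by simp

lemma lie_VF: "VF X \<Longrightarrow> VF Y \<Longrightarrow> VF (lie_bracket X Y)"
  by (simp add: torsion_free[symmetric] VF_diff nabla_VF)

lemma R_VF: "VF X \<Longrightarrow> VF Y \<Longrightarrow> VF Z \<Longrightarrow> VF (R X Y Z)"
  by (simp add: curvature_def VF_diff nabla_VF lie_VF)

lemma lie_antisym: "lie_bracket Y X = - lie_bracket X Y"
  by (auto simp: lie_bracket_def fun_eq_iff)

lemma nabla_uminus_left: "VF X \<Longrightarrow> VF Z \<Longrightarrow> nabla (- X) Z = - nabla X Z"
  using nabla_diff_left[of 0 X Z] nabla_diff_left[of X X Z] VF_zero by simp

lemma R_antisym: "VF X \<Longrightarrow> VF Y \<Longrightarrow> VF Z \<Longrightarrow> R Y X Z = - R X Y Z"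
  by (simp add: curvature_def lie_antisym[of Y X] nabla_uminus_left lie_VF)

lemma R_add1: "VF X \<Longrightarrow> VF X' \<Longrightarrow> VF Y \<Longrightarrow> VF Z \<Longrightarrow> R (X + X') Y Z = R X Y Z + R X' Y Z"
  by (simp add: curvature_def torsion_free[symmetric] nabla_add_left nabla_add_right
      nabla_diff_left nabla_VF VF_add VF_diff algebra_simps)

lemma R_add3: "VF X \<Longrightarrow> VF Y \<Longrightarrow> VF Z \<Longrightarrow> VF Z' \<Longrightarrow> R X Y (Z + Z') = R X Y Z + R X Y Z'"
  by (simp add: curvature_def nabla_add_right nabla_VF VF_add lie_VF)

lemma fmult_simps:
  "f *\<^sub>F (X + Y) = f *\<^sub>F X + f *\<^sub>F Y" "f *\<^sub>F (X - Y) = f *\<^sub>F X - f *\<^sub>F Y"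
  by (auto simp: fmult_def fun_eq_iff tscale_def algebra_simps)

lemma fmult_diff_left: "(\<lambda>p. f p - h p) *\<^sub>F X = f *\<^sub>F X - h *\<^sub>F X"
  by (auto simp: fmult_def fun_eq_iff tscale_def algebra_simps)

text \<open>Expressing Lie brackets by the torsion-free connection reduces their Leibniz rule to that of the
  connection.\<close>

lemma R_fmult1:
  assumes "VF X" "VF Y" "VF Z" "smooth f"
  shows "R (f *\<^sub>F X) Y Z = f *\<^sub>F R X Y Z"
  using assms
  by (simp add: curvature_def torsion_free[symmetric] nabla_fmult_left nabla_fmult_right
      nabla_diff_left nabla_add_left nabla_VF VF_add VF_diff VF_fmult VF_smooth fmult_simps)

lemma R_fmult3:
  assumes X: "VF X" and Y: "VF Y" and Z: "VF Z" and f: "smooth f"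
  shows "R X Y (f *\<^sub>F Z) = f *\<^sub>F R X Y Z"
proof -
  have "nabla U (nabla V (f *\<^sub>F Z)) = (\<lambda>p. U p (\<lambda>q. V q f)) *\<^sub>F Z + (\<lambda>p. V p f) *\<^sub>F nabla U Z
      + ((\<lambda>p. U p f) *\<^sub>F nabla V Z + f *\<^sub>F nabla U (nabla V Z))" if "VF U" "VF V" for U V
    using that Z f by (simp add: nabla_fmult_right nabla_add_right nabla_VF VF_fmult VF_smooth)
  moreover have "nabla (lie_bracket X Y) (f *\<^sub>F Z) =
      (\<lambda>p. X p (\<lambda>q. Y q f)) *\<^sub>F Z - (\<lambda>p. Y p (\<lambda>q. X q f)) *\<^sub>F Z + f *\<^sub>F nabla (lie_bracket X Y) Z"
    using assms by (simp add: nabla_fmult_right lie_VF) (simp add: lie_bracket_def fmult_diff_left)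
  ultimately show ?thesis
    using X Y by (simp add: curvature_def fmult_simps)
qed

lemma jacobi:
  assumes X: "VF X" and Y: "VF Y" and Z: "VF Z"
  shows "lie_bracket X (lie_bracket Y Z) + lie_bracket Y (lie_bracket Z X) + lie_bracket Z (lie_bracket X Y) = 0"
proof (intro ext)
  fix p f
  show "(lie_bracket X (lie_bracket Y Z) + lie_bracket Y (lie_bracket Z X) + lie_bracket Z (lie_bracket X Y)) p f = 0 p f"
  proof (cases "smooth f")
    case True
    have d: "U p (\<lambda>q. V q (\<lambda>r. W r f) - W q (\<lambda>r. V r f)) = U p (\<lambda>q. V q (\<lambda>r. W r f)) - U p (\<lambda>q. W q (\<lambda>r. V r f))"
      if "VF U" "VF V" "VF W" for U V W
      by (rule T_diff[OF VF_T[OF that(1)]]) (use True that VF_smooth in auto)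
    show ?thesis
      by (simp add: lie_bracket_def d X Y Z)
  next
    case False
    have "lie_bracket U (lie_bracket V W) p f = 0" if "VF U" "VF V" "VF W" for U V W
      by (rule T_nonsmooth[OF VF_T[OF lie_VF[OF that(1) lie_VF[OF that(2,3)]]] False])
    then show ?thesis using X Y Z by simp
  qed
qed

lemma bianchi:
  assumes X: "VF X" and Y: "VF Y" and Z: "VF Z"
  shows "R X Y Z + R Y Z X + R Z X Y = 0"
proof -
  have e: "lie_bracket U (lie_bracket V W) = nabla U (nabla V W) - nabla U (nabla W V) - nabla (lie_bracket V W) U"
    if "VF U" "VF V" "VF W" for U V W
    using that by (simp add: torsion_free[of U "lie_bracket V W", symmetric] lie_VF)
       (simp add: torsion_free[of V W, symmetric] nabla_diff_right nabla_VF)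
  show ?thesis
    using jacobi[OF X Y Z] X Y Z by (simp add: e curvature_def algebra_simps)
qed

lemma R_skew:
  assumes X: "VF X" and Y: "VF Y" and Z: "VF Z" and W: "VF W"
  shows "g p (R X Y Z p) (W p) + g p (Z p) (R X Y W p) = 0"
proof -
  let ?f = "\<lambda>q. g q (Z q) (W q)"
  have second: "U p (\<lambda>q. V q ?f) = g p (nabla U (nabla V Z) p) (W p) + g p (nabla V Z p) (nabla U W p)
      + (g p (nabla U Z p) (nabla V W p) + g p (Z p) (nabla U (nabla V W) p))"
    if "VF U" "VF V" for U V
  proof -
    have "U p (\<lambda>q. V q ?f) = U p (\<lambda>q. g q (nabla V Z q) (W q) + g q (Z q) (nabla V W q))"
      using that Z W by (simp add: nabla_metric)
    also have "\<dots> = U p (\<lambda>q. g q (nabla V Z q) (W q)) + U p (\<lambda>q. g q (Z q) (nabla V W q))"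
      by (rule T_add[OF VF_T[OF that(1)]]) (use that Z W in \<open>auto intro: g_smooth nabla_VF\<close>)
    finally show ?thesis using that Z W by (simp add: nabla_metric nabla_VF)
  qed
  have "X p (\<lambda>q. Y q ?f) - Y p (\<lambda>q. X q ?f)
      = g p (nabla (lie_bracket X Y) Z p) (W p) + g p (Z p) (nabla (lie_bracket X Y) W p)"
    using nabla_metric[OF lie_VF[OF X Y] Z W, of p] by (simp add: lie_bracket_def)
  moreover have "V p \<in> T p" if "VF V" for V using VF_T[OF that] .
  ultimately show ?thesis
    using X Y Z W
    by (simp add: curvature_def second g_diff_left g_diff_right T_minus VF_T nabla_VF lie_VF)
qed

text \<open>The octahedron argument: the four cyclic identities for the arguments, together with the two
  antisymmetries, are linear equations that imply the claim.\<close>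

lemma R_pair_symmetry:
  assumes X: "VF X" and Y: "VF Y" and Z: "VF Z" and W: "VF W"
  shows "g p (R X Y Z p) (W p) = g p (R Z W X p) (Y p)"
proof -
  let ?S = "\<lambda>X Y Z W. g p (R X Y Z p) (W p)"
  have a: "?S V U M N = - ?S U V M N" if "VF U" "VF V" "VF M" "VF N" for U V M N
    using that by (simp add: R_antisym[of U V M] g_uminus_left VF_T R_VF)
  have s: "?S U V N M = - ?S U V M N" if "VF U" "VF V" "VF M" "VF N" for U V M N
    using R_skew[OF that, of p] g_sym[OF VF_T[OF that(3)] VF_T[OF R_VF[OF that(1,2,4)]]] by simp
  have b: "?S U V M N + ?S V M U N + ?S M U V N = 0" if "VF U" "VF V" "VF M" "VF N" for U V M N
  proof -
    have "g p ((R U V M + R V M U + R M U V) p) (N p) = 0"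
      using bianchi[OF that(1-3)] g_scale_left[of 0 p "N p" 0] that VF_T T_zero by simp
    then show ?thesis using that by (simp add: g_add_left T_plus VF_T R_VF)
  qed
  show ?thesis
    using b[OF X Y Z W] b[OF Y Z W X] b[OF Z W X Y] b[OF W X Y Z]
      a[OF X Y Z W] a[OF Y Z X W] a[OF Z X Y W] a[OF Y Z W X] a[OF Z W Y X] a[OF W Y Z X]
      a[OF Z W X Y] a[OF W X Z Y] a[OF X Z W Y] a[OF W X Y Z] a[OF X Y W Z] a[OF Y W X Z]
      s[OF X Y Z W] s[OF Y Z X W] s[OF Z X Y W] s[OF Y Z W X] s[OF Z W Y X] s[OF W Y Z X]
      s[OF Z W X Y] s[OF W X Z Y] s[OF X Z W Y] s[OF W X Y Z] s[OF X Y W Z] s[OF Y W X Z]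
    by linarith
qed

lemma R_tensorial1: "VF Y \<Longrightarrow> VF Z \<Longrightarrow> tensorial_at p (\<lambda>X. R X Y Z p)"
  by (simp add: tensorial_at_def R_add1 R_fmult1) (simp add: fmult_def)

lemma R_tensorial3: "VF X \<Longrightarrow> VF Y \<Longrightarrow> tensorial_at p (\<lambda>Z. R X Y Z p)"
  by (simp add: tensorial_at_def R_add3 R_fmult3) (simp add: fmult_def)

lemma Ric_cong:
  assumes "VF Y" "VF Z" "VF Z'" "Z p = Z' p"
  shows "Ric Y Z p = Ric Y Z' p"
  unfolding ricci_def
  by (rule trace_cong) (rule tensorial_at_cong[OF R_tensorial3], use assms extend_VF in auto)

lemma Ric_add: "VF Y \<Longrightarrow> VF Z \<Longrightarrow> VF Z' \<Longrightarrow> Ric Y (Z + Z') p = Ric Y Z p + Ric Y Z' p"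
  unfolding ricci_def
  by (subst trace_add[symmetric]) (auto intro!: trace_cong simp: R_add3 extend_VF VF_T R_VF)

lemma Ric_fmult: "VF Y \<Longrightarrow> VF Z \<Longrightarrow> smooth f \<Longrightarrow> Ric Y (f *\<^sub>F Z) p = f p * Ric Y Z p"
  unfolding ricci_def
  by (subst trace_scale[symmetric])
     (auto intro!: trace_cong simp: R_fmult3 extend_VF VF_T R_VF, simp add: fmult_def)

text \<open>Near each point the trace is computed in a frame of smooth fields.\<close>

lemma Ric_smooth:
  assumes Y: "VF Y" and Z: "VF Z"
  shows "smooth (\<lambda>p. Ric Y Z p)"
proof (rule smooth_locally)
  fix p
  obtain W x E where F: "p \<in> W" "local_frame W x E" using local_frame_exists by blast
  let ?u = "\<lambda>q. \<Sum>i\<in>Basis. R (E i) Y Z q (x i)"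
  have "Ric Y Z q = ?u q" if q: "q \<in> W" for q
  proof -
    have Eq: "E i q \<in> T q" for i using local_frame_VF[OF F(2)] VF_T by blast
    have "Ric Y Z q = (\<Sum>i\<in>Basis. R (extend_tvec A q (E i q)) Y Z q (x i))"
      unfolding ricci_def
    proof (rule trace_frame)
      show "R (extend_tvec A q v) Y Z q \<in> T q" if "v \<in> T q" for v
        using that Y Z extend_VF R_VF VF_T by blast
      show "lin_on q (\<lambda>v. R (extend_tvec A q v) Y Z q f)" for f
        using tensorial_at_lin_on[OF R_tensorial1[OF Y Z]] .
    qed (use Eq local_frame_expand[OF F(2) q] in auto)
    moreover have "R (extend_tvec A q (E i q)) Y Z q = R (E i) Y Z q" for i
      by (rule tensorial_at_cong[OF R_tensorial1[OF Y Z]])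
         (use Eq extend_VF extend_at local_frame_VF[OF F(2)] in auto)
    ultimately show ?thesis by simp
  qed
  moreover have "smooth ?u"
    by (rule smooth_sum)
       (rule VF_smooth[OF R_VF[OF local_frame_VF[OF F(2)] Y Z] local_frame_smooth[OF F(2)]])
  ultimately show "\<exists>W u. open W \<and> p \<in> W \<and> smooth u \<and> (\<forall>q\<in>W. Ric Y Z q = u q)"
    using F(1) local_frame_open[OF F(2)] by blast
qed

lemma Q_unique:
  assumes X: "VF X" and w: "w \<in> T p" "\<And>Y. VF Y \<Longrightarrow> g p w (Y p) = Ric X Y p"
  shows "Q X p = w"
  unfolding ricci_operator_def
proof (rule the_equality)
  fix w' assume w': "w' \<in> T p \<and> (\<forall>Y. VF Y \<longrightarrow> g p w' (Y p) = Ric X Y p)"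
  show "w' = w"
  proof (rule g_eqI)
    fix v assume "v \<in> T p"
    then show "g p w' v = g p w v" using w w' extend_VF extend_at by metis
  qed (use w w' in auto)
qed (use w in auto)

text \<open>The Ricci tensor is tensorial in its second argument, so that it defines a linear form on each
  tangent space, which the metric represents by a vector.\<close>

lemma Q_T_and_g_Q:
  assumes X: "VF X"
  shows "Q X p \<in> T p \<and> (\<forall>Y. VF Y \<longrightarrow> g p (Q X p) (Y p) = Ric X Y p)"
proof -
  let ?e = "extend_tvec A p"
  let ?\<alpha> = "\<lambda>v. Ric X (?e v) p"
  have "?\<alpha> (u + v) = ?\<alpha> u + ?\<alpha> v" if "u \<in> T p" "v \<in> T p" for u v
    using Ric_cong[OF X, of "?e (u + v)" "?e u + ?e v" p] Ric_add[OF X, of "?e u" "?e v" p]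
      that extend_VF extend_at T_plus VF_add by simp
  moreover have "?\<alpha> (k *\<^sub>T v) = k * ?\<alpha> v" if "v \<in> T p" for k v
  proof -
    have "((\<lambda>_. k) *\<^sub>F ?e v) p = k *\<^sub>T v" using extend_at[OF that] by (simp add: fmult_def)
    then show ?thesis
      using Ric_cong[OF X, of "?e (k *\<^sub>T v)" "(\<lambda>_. k) *\<^sub>F ?e v" p] Ric_fmult[OF X, of "?e v" "\<lambda>_. k" p]
        that extend_VF extend_at T_tscale VF_fmult smooth_const by simp
  qed
  ultimately have "lin_on p ?\<alpha>" by (simp add: lin_on_def)
  from riesz_exists[OF this] obtain w where w: "w \<in> T p" "\<forall>v\<in>T p. g p w v = ?\<alpha> v" by blast
  have "g p w (Y p) = Ric X Y p" if "VF Y" for Y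
    using w(2) VF_T[OF that, of p] Ric_cong[OF X _ that, of "?e (Y p)" p] extend_VF extend_at by metis
  then show ?thesis using Q_unique[OF X w(1)] w(1) by auto
qed

lemma g_Q: "VF X \<Longrightarrow> VF Y \<Longrightarrow> g p (Q X p) (Y p) = Ric X Y p"
  using Q_T_and_g_Q by blast

end

section \<open>Kenmotsu pseudo-metric manifolds\<close>

locale kenmotsu_manifold = smooth_manifold A
  for A :: "('a::{t2_space, second_countable_topology}, 'e::euclidean_space) chart set" +
  fixes \<phi> :: "'a \<Rightarrow> 'a tvec \<Rightarrow> 'a tvec"
    and \<xi> :: "'a vfield"
    and \<eta> :: "'a \<Rightarrow> 'a tvec \<Rightarrow> real"
    and g :: "'a \<Rightarrow> 'a tvec \<Rightarrow> 'a tvec \<Rightarrow> real"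
    and \<epsilon> :: real
    and nabla :: "'a vfield \<Rightarrow> 'a vfield \<Rightarrow> 'a vfield"
    and n :: nat
  assumes dim: "DIM('e) = 2 * n + 1" and n_pos: "n \<ge> 1"
    and lc: "levi_civita A g nabla"
    and kenmotsu: "kenmotsu_pseudo_metric A \<phi> \<xi> \<eta> g \<epsilon> nabla"
begin

lemma almost_contact: "almost_contact_pseudo_metric A \<phi> \<xi> \<eta> g \<epsilon>"
  using kenmotsu by (simp add: kenmotsu_pseudo_metric_def)

sublocale levi_civita_manifold A g nabla
  using almost_contact lc by unfold_locales (auto simp: almost_contact_pseudo_metric_def)

lemma
  shows phi_T: "v \<in> T p \<Longrightarrow> \<phi> p v \<in> T p"
    and xi_VF: "VF \<xi>"
    and eta_lin: "lin_on p (\<eta> p)"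
    and eta_smooth: "VF X \<Longrightarrow> smooth (\<lambda>p. \<eta> p (X p))"
    and eps_sq: "\<epsilon> * \<epsilon> = 1"
    and eta_xi: "\<eta> p (\<xi> p) = 1"
    and phi_xi: "\<phi> p (\<xi> p) = 0"
    and phi_phi: "v \<in> T p \<Longrightarrow> \<phi> p (\<phi> p v) = - v + \<eta> p v *\<^sub>T \<xi> p"
    and g_phi_phi: "VF X \<Longrightarrow> VF Y \<Longrightarrow> g p (\<phi> p (X p)) (\<phi> p (Y p)) = g p (X p) (Y p) - \<epsilon> * \<eta> p (X p) * \<eta> p (Y p)"
proof -
  note ac = almost_contact[unfolded almost_contact_pseudo_metric_def]
  show "v \<in> T p \<Longrightarrow> \<phi> p v \<in> T p" using ac unfolding tensor_11_def by blast
  show "VF \<xi>" using ac by blast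
  show "lin_on p (\<eta> p)" using ac unfolding one_form_def lin_on_def by blast
  show "VF X \<Longrightarrow> smooth (\<lambda>p. \<eta> p (X p))" using ac unfolding one_form_def by blast
  show "\<epsilon> * \<epsilon> = 1" using ac by auto
  show "\<eta> p (\<xi> p) = 1" "\<phi> p (\<xi> p) = 0" using ac by blast+
  show "v \<in> T p \<Longrightarrow> \<phi> p (\<phi> p v) = - v + \<eta> p v *\<^sub>T \<xi> p" using ac by blast
  show "VF X \<Longrightarrow> VF Y \<Longrightarrow> g p (\<phi> p (X p)) (\<phi> p (Y p)) = g p (X p) (Y p) - \<epsilon> * \<eta> p (X p) * \<eta> p (Y p)"
    using ac by blast
qed

lemma kenmotsu_eq:
  "VF X \<Longrightarrow> VF Y \<Longrightarrow> nabla X (\<lambda>q. \<phi> q (Y q)) p - \<phi> p (nabla X Y p) =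
     - (\<eta> p (Y p) *\<^sub>T \<phi> p (X p)) - (\<epsilon> * g p (X p) (\<phi> p (Y p))) *\<^sub>T \<xi> p"
  using kenmotsu unfolding kenmotsu_pseudo_metric_def by blast

lemma xi_T: "\<xi> p \<in> T p"
  using xi_VF VF_T by blast

lemma eta_add: "u \<in> T p \<Longrightarrow> v \<in> T p \<Longrightarrow> \<eta> p (u + v) = \<eta> p u + \<eta> p v"
  and eta_scale: "v \<in> T p \<Longrightarrow> \<eta> p (k *\<^sub>T v) = k * \<eta> p v"
  using eta_lin[of p] by (auto simp: lin_on_def)

lemma eta_diff: "u \<in> T p \<Longrightarrow> v \<in> T p \<Longrightarrow> \<eta> p (u - v) = \<eta> p u - \<eta> p v"
  using eta_add[of "u - v" p v] T_minus by simp

lemma g_zero_right: "v \<in> T p \<Longrightarrow> g p v 0 = 0"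
  using g_scale_right[of 0 p v 0] T_zero by simp

lemma g_xi: 
  assumes "v \<in> T p" shows "g p v (\<xi> p) = \<epsilon> * \<eta> p v"
  using g_phi_phi[OF extend_VF[OF assms] xi_VF, of p] assms
  by (simp add: extend_at phi_xi eta_xi g_zero_right phi_T)

lemma xi_g: "v \<in> T p \<Longrightarrow> g p (\<xi> p) v = \<epsilon> * \<eta> p v"
  using g_xi g_sym xi_T by metis

text \<open>The Kenmotsu equation for \<open>Y = \<xi>\<close> gives \<open>\<phi> (\<nabla>\<^sub>X \<xi>) = \<phi> X\<close>, and \<open>\<phi>\<close> is injective up to multiples
  of \<open>\<xi>\<close>. The remaining \<open>\<xi>\<close>-component of \<open>\<nabla>\<^sub>X \<xi>\<close> vanishes because \<open>g \<xi> \<xi>\<close> is constant.\<close>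

lemma nabla_xi:
  assumes X: "VF X"
  shows "nabla X \<xi> = X - (\<lambda>q. \<eta> q (X q)) *\<^sub>F \<xi>"
proof
  fix p
  let ?N = "nabla X \<xi> p"
  have XT: "X p \<in> T p" and NT: "?N \<in> T p" using X xi_VF nabla_VF VF_T by blast+
  have "X p (\<lambda>q. g q (\<xi> q) (\<xi> q)) = g p ?N (\<xi> p) + g p (\<xi> p) ?N"
    by (rule nabla_metric[OF X xi_VF xi_VF])
  then have "\<epsilon> * \<eta> p ?N = 0"
    by (simp add: g_xi xi_g xi_T NT eta_xi T_const[OF XT])
  then have eN: "\<eta> p ?N = 0" using eps_sq by auto
  have "nabla X (\<lambda>q. \<phi> q (\<xi> q)) = nabla X 0" by (simp add: phi_xi zero_fun_def)
  also have "\<dots> = 0" using nabla_diff_right[OF xi_VF xi_VF X] by simp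
  finally have "- \<phi> p ?N = - \<phi> p (X p)"
    using kenmotsu_eq[OF X xi_VF, of p] by (simp add: phi_xi eta_xi g_zero_right XT)
  then have "\<phi> p (\<phi> p ?N) = \<phi> p (\<phi> p (X p))" by simp
  then have e: "- ?N = - X p + \<eta> p (X p) *\<^sub>T \<xi> p" by (simp add: phi_phi XT NT eN)
  have "?N = - (- ?N)" by simp
  also have "\<dots> = X p - \<eta> p (X p) *\<^sub>T \<xi> p" unfolding e by simp
  finally show "?N = (X - (\<lambda>q. \<eta> q (X q)) *\<^sub>F \<xi>) p" by (simp add: fmult_def)
qed

text \<open>Differentiating \<open>\<eta> V = \<epsilon> g V \<xi>\<close> along \<open>U\<close> produces \<open>\<eta> (\<nabla>\<^sub>U V)\<close> and terms symmetric in \<open>U\<close> and \<open>V\<close>,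
  which cancel.\<close>

lemma eta_closed:
  assumes X: "VF X" and Y: "VF Y"
  shows "X p (\<lambda>q. \<eta> q (Y q)) - Y p (\<lambda>q. \<eta> q (X q)) = \<eta> p (lie_bracket X Y p)"
proof -
  have d: "U p (\<lambda>q. \<eta> q (V q)) = \<eta> p (nabla U V p) + \<epsilon> * g p (U p) (V p) - \<eta> p (U p) * \<eta> p (V p)"
    if U: "VF U" and V: "VF V" for U V
  proof -
    note in_T = VF_T[OF U] VF_T[OF V] VF_T[OF nabla_VF[OF U V]] xi_T
    have "\<eta> q (V q) = \<epsilon> * g q (V q) (\<xi> q)" for q
      using eps_sq by (simp add: g_xi VF_T[OF V] mult.assoc[symmetric])
    then have "U p (\<lambda>q. \<eta> q (V q)) = \<epsilon> * U p (\<lambda>q. g q (V q) (\<xi> q))"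
      using T_scale[OF in_T(1) g_smooth[OF V xi_VF], where k = \<epsilon>] by simp
    also have "\<dots> = \<epsilon> * (\<epsilon> * \<eta> p (nabla U V p) + (g p (V p) (U p) - \<eta> p (U p) * (\<epsilon> * \<eta> p (V p))))"
      unfolding nabla_metric[OF U V xi_VF] nabla_xi[OF U]
      using in_T by (simp add: g_xi fmult_def g_diff_right g_scale_right T_tscale)
    also have "\<dots> = (\<epsilon> * \<epsilon>) * \<eta> p (nabla U V p) + \<epsilon> * g p (V p) (U p) - (\<epsilon> * \<epsilon>) * (\<eta> p (U p) * \<eta> p (V p))"
      by (simp add: algebra_simps)
    finally show ?thesis using g_sym in_T by (simp add: eps_sq)
  qed
  show ?thesis
    using X Y g_sym[OF VF_T[OF X] VF_T[OF Y]]
    by (simp add: d torsion_free[symmetric] eta_diff VF_T nabla_VF)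
qed

lemma R_xi:
  assumes X: "VF X" and Y: "VF Y"
  shows "R X Y \<xi> p = \<eta> p (X p) *\<^sub>T Y p - \<eta> p (Y p) *\<^sub>T X p"
proof -
  have nn: "nabla U (nabla V \<xi>) = nabla U V - ((\<lambda>p. U p (\<lambda>q. \<eta> q (V q))) *\<^sub>F \<xi> +
      (\<lambda>q. \<eta> q (V q)) *\<^sub>F (U - (\<lambda>q. \<eta> q (U q)) *\<^sub>F \<xi>))" if U: "VF U" and V: "VF V" for U V
    using U V by (simp add: nabla_xi nabla_diff_right nabla_fmult_right VF_fmult eta_smooth xi_VF)
  have nl: "nabla (lie_bracket X Y) \<xi> = (nabla X Y - nabla Y X) - (\<lambda>q. \<eta> q (lie_bracket X Y q)) *\<^sub>F \<xi>"
    using nabla_xi[OF lie_VF[OF X Y]] torsion_free[OF X Y] by simp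
  have c: "\<eta> p (lie_bracket X Y p) = X p (\<lambda>q. \<eta> q (Y q)) - Y p (\<lambda>q. \<eta> q (X q))"
    using eta_closed[OF X Y] by simp
  show ?thesis
    by (rule ext) (simp add: curvature_def nn[OF X Y] nn[OF Y X] nl c fmult_def tscale_def algebra_simps)
qed

text \<open>Pair symmetry moves \<open>\<xi>\<close> into the third slot, where \<open>R_xi\<close> applies.\<close>

lemma R_second_xi:
  assumes X: "VF X" and Y: "VF Y"
  shows "R X \<xi> Y p = (\<epsilon> * g p (Y p) (X p)) *\<^sub>T \<xi> p + (- \<eta> p (Y p)) *\<^sub>T X p"
proof (rule g_eqI)
  note in_T = VF_T[OF X] VF_T[OF Y] xi_T
  show "R X \<xi> Y p \<in> T p" using X Y xi_VF R_VF VF_T by blast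
  show "(\<epsilon> * g p (Y p) (X p)) *\<^sub>T \<xi> p + (- \<eta> p (Y p)) *\<^sub>T X p \<in> T p"
    using in_T by (intro T_plus T_tscale)
  fix w assume w: "w \<in> T p"
  let ?W = "extend_tvec A p w"
  note W = extend_VF[OF w] extend_at[OF w]
  have "g p (R X \<xi> Y p) w = g p (R Y ?W X p) (\<xi> p)"
    using R_pair_symmetry[OF X xi_VF Y W(1), of p] W(2) by simp
  also have "\<dots> = - g p (X p) (R Y ?W \<xi> p)"
    using R_skew[OF Y W(1) X xi_VF, of p] by simp
  also have "\<dots> = \<eta> p w * g p (X p) (Y p) - \<eta> p (Y p) * g p (X p) w"
    using in_T w W by (simp add: R_xi Y g_diff_right g_scale_right T_tscale)
  also have "\<dots> = (\<epsilon> * \<epsilon>) * (\<eta> p w * g p (X p) (Y p)) - \<eta> p (Y p) * g p (X p) w"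
    by (simp add: eps_sq)
  also have "\<dots> = g p ((\<epsilon> * g p (Y p) (X p)) *\<^sub>T \<xi> p + (- \<eta> p (Y p)) *\<^sub>T X p) w"
    using in_T w g_sym[OF in_T(1,2)] by (simp add: g_diff_left g_scale_left T_tscale xi_g algebra_simps)
  finally show "g p (R X \<xi> Y p) w = g p ((\<epsilon> * g p (Y p) (X p)) *\<^sub>T \<xi> p + (- \<eta> p (Y p)) *\<^sub>T X p) w" .
qed

lemma Ric_xi:
  assumes Y: "VF Y" shows "Ric Y \<xi> p = - 2 * real n * \<eta> p (Y p)"
proof -
  have "Ric Y \<xi> p = \<eta> p (Y p) + (- \<eta> p (Y p)) * DIM('e)"
    unfolding ricci_def
    by (rule trace_rank_one_plus_scalar[OF eta_lin VF_T[OF Y]])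
       (simp add: R_xi[OF extend_VF Y] extend_at tvec.scale_minus_left)
  then show ?thesis by (simp add: dim algebra_simps)
qed

text \<open>Together with \<open>Ric_xi\<close> this is the symmetry of the Ricci tensor in the only case where it is
  needed; it avoids showing that the trace of a skew endomorphism vanishes.\<close>

lemma Ric_first_xi:
  assumes Y: "VF Y" shows "Ric \<xi> Y p = - 2 * real n * \<eta> p (Y p)"
proof -
  have lin: "lin_on p (\<lambda>v. \<epsilon> * g p (Y p) v)"
    using lin_on_g[OF VF_T[OF Y]] by (simp add: lin_on_def algebra_simps)
  have "Ric \<xi> Y p = \<epsilon> * g p (Y p) (\<xi> p) + (- \<eta> p (Y p)) * DIM('e)"
    unfolding ricci_def
    by (rule trace_rank_one_plus_scalar[OF lin xi_T]) (simp only: R_second_xi[OF extend_VF Y] extend_at)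
  moreover have "\<epsilon> * g p (Y p) (\<xi> p) = (\<epsilon> * \<epsilon>) * \<eta> p (Y p)" by (simp add: g_xi VF_T[OF Y])
  ultimately show ?thesis by (simp add: dim eps_sq algebra_simps)
qed

lemma Q_xi: "Q \<xi> p = (- 2 * real n * \<epsilon>) *\<^sub>T \<xi> p"
proof (rule Q_unique[OF xi_VF T_tscale[OF xi_T]])
  fix Y assume Y: "VF Y"
  have "g p ((- 2 * real n * \<epsilon>) *\<^sub>T \<xi> p) (Y p) = - 2 * real n * (\<epsilon> * \<epsilon>) * \<eta> p (Y p)"
    unfolding g_scale_left[OF xi_T VF_T[OF Y]] xi_g[OF VF_T[OF Y]] by simp
  then show "g p ((- 2 * real n * \<epsilon>) *\<^sub>T \<xi> p) (Y p) = Ric \<xi> Y p" by (simp add: eps_sq Ric_first_xi[OF Y])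
qed

text \<open>Otherwise the metric would vanish on the kernel of \<open>\<eta>\<close> by polarization, the kernel would be zero by
  nondegeneracy, and the tangent space would be spanned by \<open>\<xi>\<close>, contradicting \<open>n \<ge> 1\<close>.\<close>

lemma transverse_non_null:
  "\<exists>v\<in>T p. \<eta> p v = 0 \<and> g p v v \<noteq> 0"
proof (rule ccontr)
  assume "\<not> ?thesis"
  then have null: "g p v v = 0" if "v \<in> T p" "\<eta> p v = 0" for v using that by blast
  have orth: "g p u v = 0" if u: "u \<in> T p" "\<eta> p u = 0" and v: "v \<in> T p" "\<eta> p v = 0" for u v
    using null[of "u + v"] null[OF u] null[OF v] u v g_sym[OF u(1) v(1)]
    by (simp add: T_plus eta_add g_add_left g_add_right)
  have horizontal: "w - \<eta> p w *\<^sub>T \<xi> p \<in> T p" "\<eta> p (w - \<eta> p w *\<^sub>T \<xi> p) = 0" if "w \<in> T p" for w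
    using that by (simp_all add: T_minus T_tscale xi_T eta_diff eta_scale eta_xi)
  have zero: "u = 0" if u: "u \<in> T p" "\<eta> p u = 0" for u
  proof (rule g_nondegenerate[OF u(1)])
    fix w assume w: "w \<in> T p"
    have "g p u (w - \<eta> p w *\<^sub>T \<xi> p) = 0" by (rule orth[OF u horizontal[OF w]])
    then show "g p u w = 0" using u w by (simp add: g_diff_right g_scale_right T_tscale xi_T g_xi)
  qed
  have "w \<in> tvec.span {\<xi> p}" if "w \<in> T p" for w
  proof -
    have "w = \<eta> p w *\<^sub>T \<xi> p" using zero[OF horizontal[OF that]] by simp
    then show ?thesis by (metis tvec.span_base tvec.span_scale singletonI)
  qed
  moreover obtain B where B: "tvec.independent B" "B \<subseteq> T p" "card B = DIM('e)"
    using tangent_trace_basis[of p] by blast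
  ultimately have "card B \<le> card {\<xi> p}"
    using tvec.independent_span_bound[of "{\<xi> p}" B] by auto
  then show False using B(3) dim n_pos by simp
qed

lemma conformal_xi:
  assumes X: "VF X" and Y: "VF Y"
  shows "conformal_curvature n A g nabla X Y \<xi> p =
     (\<eta> p (X p) *\<^sub>T Y p - \<eta> p (Y p) *\<^sub>T X p)
     - (1 / (2 * real n - 1)) *\<^sub>T
       ((- 2 * real n * \<eta> p (Y p)) *\<^sub>T X p + (\<epsilon> * \<eta> p (Y p)) *\<^sub>T Q X p
        - (- 2 * real n * \<eta> p (X p)) *\<^sub>T Y p - (\<epsilon> * \<eta> p (X p)) *\<^sub>T Q Y p)
     + (scalar_curvature A g nabla p / (2 * real n * (2 * real n - 1))) *\<^sub>T
       ((\<epsilon> * \<eta> p (Y p)) *\<^sub>T X p - (\<epsilon> * \<eta> p (X p)) *\<^sub>T Y p)"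
  by (simp only: conformal_curvature_def R_xi[OF X Y] Ric_xi[OF X] Ric_xi[OF Y]
      g_xi[OF VF_T[OF X]] g_xi[OF VF_T[OF Y]])

text \<open>The equation \<open>C(X, \<xi>) \<xi> = 0\<close>, solved for \<open>Q X\<close>; it is enough for the whole forward direction.\<close>

lemma xi_flat_ricci_operator:
  fixes p :: 'a
  assumes flat: "xi_conformally_flat n A \<xi> g nabla" and X: "VF X"
  defines "a \<equiv> \<epsilon> + scalar_curvature A g nabla p / (2 * real n)"
  shows "Q X p = a *\<^sub>T X p + (\<epsilon> * (- 2 * real n - \<epsilon> * a) * \<eta> p (X p)) *\<^sub>T \<xi> p"
proof
  fix f
  let ?r = "scalar_curvature A g nabla p" and ?h = "\<eta> p (X p)"
  let ?x = "X p f" and ?z = "\<xi> p f" and ?q = "Q X p f"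
  define m where "m = 2 * real n"
  have m: "m - 1 \<noteq> 0" "m \<noteq> 0" using n_pos by (auto simp: m_def)
  have "conformal_curvature n A g nabla X \<xi> \<xi> p f = 0"
    using flat X xi_VF unfolding xi_conformally_flat_def by simp
  then have "(?h * ?z - ?x) - (1 / (m - 1)) * (- m * ?x + \<epsilon> * ?q + m * ?h * ?z - \<epsilon> * ?h * (- m * \<epsilon> * ?z))
      + (?r / (m * (m - 1))) * (\<epsilon> * ?x - \<epsilon> * ?h * ?z) = 0"
    unfolding conformal_xi[OF X xi_VF] Q_xi by (simp add: tscale_def eta_xi m_def algebra_simps)
  then have "(m - 1) * ((?h * ?z - ?x) - (1 / (m - 1)) * (- m * ?x + \<epsilon> * ?q + m * ?h * ?z - \<epsilon> * ?h * (- m * \<epsilon> * ?z))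
      + (?r / (m * (m - 1))) * (\<epsilon> * ?x - \<epsilon> * ?h * ?z)) = 0" by simp
  moreover have "(m - 1) * ((?h * ?z - ?x) - (1 / (m - 1)) * (- m * ?x + \<epsilon> * ?q + m * ?h * ?z - \<epsilon> * ?h * (- m * \<epsilon> * ?z))
      + (?r / (m * (m - 1))) * (\<epsilon> * ?x - \<epsilon> * ?h * ?z))
     = (m - 1) * (?h * ?z - ?x) - (- m * ?x + \<epsilon> * ?q + m * ?h * ?z + m * ?h * ?z * (\<epsilon> * \<epsilon>))
      + \<epsilon> * (?r / m) * (?x - ?h * ?z)"
    using m by (simp add: divide_simps) (simp add: algebra_simps)
  ultimately have "\<epsilon> * ?q = (1 + \<epsilon> * (?r / m)) * ?x - (1 + m + \<epsilon> * (?r / m)) * (?h * ?z)"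
    by (simp add: eps_sq algebra_simps)
  then have "(\<epsilon> * \<epsilon>) * ?q = (\<epsilon> + (\<epsilon> * \<epsilon>) * (?r / m)) * ?x - (\<epsilon> + m * \<epsilon> + (\<epsilon> * \<epsilon>) * (?r / m)) * (?h * ?z)"
    by (simp only: mult.assoc) (simp add: algebra_simps)
  then have q: "?q = (\<epsilon> + ?r / m) * ?x - (\<epsilon> + m * \<epsilon> + ?r / m) * (?h * ?z)"
    by (simp only: eps_sq mult_1)
  have "\<epsilon> * (- m - \<epsilon> * a) = - m * \<epsilon> - (\<epsilon> * \<epsilon>) * a" by (simp add: algebra_simps)
  then have b: "\<epsilon> * (- m - \<epsilon> * a) = - m * \<epsilon> - a" by (simp add: eps_sq)
  have "(a *\<^sub>T X p + (\<epsilon> * (- 2 * real n - \<epsilon> * a) * ?h) *\<^sub>T \<xi> p) f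
      = a * ?x + (\<epsilon> * (- m - \<epsilon> * a)) * ?h * ?z" by (simp add: tscale_def m_def)
  also have "\<dots> = ?q" unfolding b q unfolding a_def m_def by (simp add: algebra_simps)
  finally show "?q = (a *\<^sub>T X p + (\<epsilon> * (- 2 * real n - \<epsilon> * a) * ?h) *\<^sub>T \<xi> p) f" by (rule sym)
qed

lemma xi_flat_imp_eta_einstein:
  assumes flat: "xi_conformally_flat n A \<xi> g nabla"
  shows "eta_einstein A \<eta> g nabla"
proof -
  define a where "a = (\<lambda>p. \<epsilon> + scalar_curvature A g nabla p / (2 * real n))"
  define b where "b = (\<lambda>p. - 2 * real n - \<epsilon> * a p)"
  have ric: "Ric X Y p = a p * g p (X p) (Y p) + b p * \<eta> p (X p) * \<eta> p (Y p)"
    if X: "VF X" and Y: "VF Y" for X Y p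
  proof -
    have Q: "Q X p = a p *\<^sub>T X p + (\<epsilon> * b p * \<eta> p (X p)) *\<^sub>T \<xi> p"
      using xi_flat_ricci_operator[OF flat X, of p] by (simp only: a_def b_def)
    have "Ric X Y p = a p * g p (X p) (Y p) + (\<epsilon> * b p * \<eta> p (X p)) * (\<epsilon> * \<eta> p (Y p))"
      unfolding g_Q[OF X Y, symmetric] Q
      using VF_T[OF X] VF_T[OF Y] xi_T by (simp add: g_add_left g_scale_left T_tscale xi_g)
    also have "\<dots> = a p * g p (X p) (Y p) + (\<epsilon> * \<epsilon>) * (b p * \<eta> p (X p) * \<eta> p (Y p))"
      by (simp add: algebra_simps)
    finally show ?thesis by (simp add: eps_sq)
  qed
  \<comment> \<open>A quotient of smooth functions near each point, by the equation for \<open>Ric X X\<close> with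
    \<open>X\<close> horizontal and not null; this spares showing that the scalar curvature is smooth.\<close>
  have "smooth a"
  proof (rule smooth_locally_quotient)
    fix p
    obtain v where v: "v \<in> T p" "\<eta> p v = 0" "g p v v \<noteq> 0" using transverse_non_null by blast
    let ?V = "extend_tvec A p v"
    define X where "X = ?V - (\<lambda>q. \<eta> q (?V q)) *\<^sub>F \<xi>"
    have X: "VF X"
      unfolding X_def by (intro VF_diff VF_fmult eta_smooth xi_VF extend_VF v)
    have eX: "\<eta> q (X q) = 0" for q
      using VF_T[OF extend_VF[OF v(1)]] xi_T
      by (simp add: X_def fmult_def eta_diff eta_scale T_tscale eta_xi)
    have Xp: "X p = v" by (simp add: X_def fmult_def extend_at v)
    let ?w = "\<lambda>q. g q (X q) (X q)"
    have w: "smooth ?w" by (rule g_smooth[OF X X])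
    then obtain W where W: "open W" "p \<in> W" "\<forall>q\<in>W. ?w q \<noteq> 0"
      using smooth_nonzero_open[of ?w p] v(3) Xp by auto
    have "a q = Ric X X q / ?w q" if "q \<in> W" for q
      using W(3) that by (simp add: ric[OF X X] eX)
    then show "\<exists>W u w. open W \<and> p \<in> W \<and> smooth u \<and> smooth w \<and> (\<forall>q\<in>W. w q \<noteq> 0 \<and> a q = u q / w q)"
      using W Ric_smooth[OF X X] w by blast
  qed
  moreover have "smooth b"
    unfolding b_def by (intro smooth_diff smooth_mult smooth_const \<open>smooth a\<close>)
  ultimately show ?thesis
    unfolding eta_einstein_def using ric by blast
qed

text \<open>Evaluating the hypothesis at \<open>\<xi>\<close> gives \<open>\<epsilon> a + b = - 2 n\<close>, and taking traces gives \<open>r = 2 n (a - \<epsilon>)\<close>.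
  With these two values all coefficients of \<open>C(X, Y) \<xi>\<close> cancel.\<close>

lemma eta_einstein_imp_xi_flat:
  assumes "eta_einstein A \<eta> g nabla"
  shows "xi_conformally_flat n A \<xi> g nabla"
  unfolding xi_conformally_flat_def
proof (intro allI impI)
  fix X Y p assume X: "VF X" and Y: "VF Y"
  obtain a b where ric: "\<And>X Y p. VF X \<Longrightarrow> VF Y \<Longrightarrow>
      Ric X Y p = a p * g p (X p) (Y p) + b p * \<eta> p (X p) * \<eta> p (Y p)"
    using assms unfolding eta_einstein_def by blast
  have b: "b p = - 2 * real n - \<epsilon> * a p"
    using ric[OF xi_VF xi_VF, of p] by (simp add: Ric_xi[OF xi_VF] eta_xi g_xi xi_T algebra_simps)
  have Q: "Q Z p = (\<epsilon> * b p * \<eta> p (Z p)) *\<^sub>T \<xi> p + a p *\<^sub>T Z p" if Z: "VF Z" for Z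
  proof (rule Q_unique[OF Z])
    show "(\<epsilon> * b p * \<eta> p (Z p)) *\<^sub>T \<xi> p + a p *\<^sub>T Z p \<in> T p"
      by (intro T_plus T_tscale xi_T VF_T Z)
    fix Y assume Y: "VF Y"
    have "g p ((\<epsilon> * b p * \<eta> p (Z p)) *\<^sub>T \<xi> p + a p *\<^sub>T Z p) (Y p)
        = (\<epsilon> * \<epsilon>) * (b p * \<eta> p (Z p) * \<eta> p (Y p)) + a p * g p (Z p) (Y p)"
      using VF_T[OF Z] VF_T[OF Y] xi_T by (simp add: g_add_left g_scale_left T_tscale xi_g)
    then show "g p ((\<epsilon> * b p * \<eta> p (Z p)) *\<^sub>T \<xi> p + a p *\<^sub>T Z p) (Y p) = Ric Z Y p"
      by (simp add: ric[OF Z Y] eps_sq)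
  qed
  have lin: "lin_on p (\<lambda>v. \<epsilon> * b p * \<eta> p v)"
    using eta_lin[of p] by (simp add: lin_on_def algebra_simps)
  have "scalar_curvature A g nabla p = \<epsilon> * b p * \<eta> p (\<xi> p) + a p * DIM('e)"
    unfolding scalar_curvature_def
    by (rule trace_rank_one_plus_scalar[OF lin xi_T]) (simp only: Q[OF extend_VF] extend_at)
  then have "scalar_curvature A g nabla p = \<epsilon> * b p + a p * (2 * real n + 1)"
    by (simp add: dim eta_xi algebra_simps)
  also have "\<dots> = 2 * real n * (a p - \<epsilon>) + a p - (\<epsilon> * \<epsilon>) * a p" by (simp add: b algebra_simps)
  finally have r: "scalar_curvature A g nabla p / (2 * real n * (2 * real n - 1)) = (a p - \<epsilon>) / (2 * real n - 1)"
    using n_pos by (simp add: eps_sq)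
  show "conformal_curvature n A g nabla X Y \<xi> p = 0"
  proof
    fix f
    let ?h = "\<eta> p (X p)" and ?k = "\<eta> p (Y p)" and ?x = "X p f" and ?y = "Y p f" and ?z = "\<xi> p f"
    define m where "m = 2 * real n"
    have m: "m - 1 \<noteq> 0" using n_pos by (auto simp: m_def)
    have "conformal_curvature n A g nabla X Y \<xi> p f = (?h * ?y - ?k * ?x)
       - (1 / (m - 1)) * (- m * ?k * ?x + \<epsilon> * ?k * (\<epsilon> * b p * ?h * ?z + a p * ?x)
           + m * ?h * ?y - \<epsilon> * ?h * (\<epsilon> * b p * ?k * ?z + a p * ?y))
       + ((a p - \<epsilon>) / (m - 1)) * (\<epsilon> * ?k * ?x - \<epsilon> * ?h * ?y)"
      unfolding conformal_xi[OF X Y] r Q[OF X] Q[OF Y]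
      by (simp add: tscale_def m_def)
    also have "\<dots> = (1 - \<epsilon> * \<epsilon>) / (m - 1) * (?k * ?x - ?h * ?y)"
      using m by (simp add: divide_simps) (simp add: algebra_simps)
    finally show "conformal_curvature n A g nabla X Y \<xi> p f = 0 f" by (simp add: eps_sq)
  qed
qed

end

theorem theorem4:
  fixes A :: "('a::{t2_space, second_countable_topology}, 'e::euclidean_space) chart set"
    and \<phi> :: "'a \<Rightarrow> 'a tvec \<Rightarrow> 'a tvec"
    and \<xi> :: "'a vfield"
    and \<eta> :: "'a \<Rightarrow> 'a tvec \<Rightarrow> real"
    and g :: "'a \<Rightarrow> 'a tvec \<Rightarrow> 'a tvec \<Rightarrow> real"
    and \<epsilon> :: real
    and nabla :: "'a vfield \<Rightarrow> 'a vfield \<Rightarrow> 'a vfield"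
    and n :: nat
  assumes "smooth_atlas A"
    and "DIM('e) = 2 * n + 1"
    and "n \<ge> 1"
    and "levi_civita A g nabla"
    and "kenmotsu_pseudo_metric A \<phi> \<xi> \<eta> g \<epsilon> nabla"
  shows "xi_conformally_flat n A \<xi> g nabla \<longleftrightarrow> eta_einstein A \<eta> g nabla"
proof -
  interpret kenmotsu_manifold A \<phi> \<xi> \<eta> g \<epsilon> nabla n
    by unfold_locales (rule assms)+
  show ?thesis
    using xi_flat_imp_eta_einstein eta_einstein_imp_xi_flat by blast
qed

end
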